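(* Let $n\in\mathbb{N}$ and write $n=2^s(2k+1)$ with $s,k\in\mathbb{N}_0$. Then the polynomial $Q_n$ has a unique representation as a linear combination of $B_{2^s}, B_{3\cdot 2^s},\ldots,B_{(2k-1)\cdot 2^s},B_{(2k+1)\cdot 2^s}$, i.e. there are unique real coefficients $a_0,\ldots,a_k$ such that $Q_n=\sum_{j=0}^{k}a_j\,B_{(2j+1)\cdot 2^s}$.
   Context: $\mathbb{N}_0=\mathbb{N}\cup\{0\}$, $0^0:=1$. Let $\gamma=(\gamma_s)_{s=1}^\infty$ with $0<\gamma_s<1/4$ for all $s$. Put $r_0=1$ and $r_s=\gamma_s r_{s-1}^2$ for $s\ge 1$. Define polynomials recursively by $P_1(x)=x-1$ and $P_{2^{s+1}}(x)=P_{2^s}(x)\,(P_{2^s}(x)+r_s)$ for $s\in\mathbb{N}_0$. Let $E_s=\{x\in\mathbb{R}: P_{2^{s+1}}(x)\le 0\}$; then $E_{s+1}\subset E_s$ and $K(\gamma)=\bigcap_{s=0}^\infty E_s$ is a (compact) Cantor set. It is assumed throughout that $K(\gamma)$ has positive logarithmic capacity, $Cap(K(\gamma))=\exp\left(\sum_{k=1}^\infty 2^{-k}\log\gamma_k\right)>0$. $\mu_{K(\gamma)}$ is the equilibrium measure of $K(\gamma)$ and $Q_n$ is the monic orthogonal polynomial of degree $n$ with respect to $\mu_{K(\gamma)}$. For $n\in\mathbb{N}$ with $2^m\le n<2^{m+1}$, $m\in\mathbb{N}_0$, and binary representation $n=i_m2^m+\cdots+i_1 2+i_0$, $i_k\in\{0,1\}$,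 put $B_n=(Q_{2^m})^{i_m}(Q_{2^{m-1}})^{i_{m-1}}\cdots(Q_{1})^{i_0}$; $B_n$ is a monic polynomial of degree $n$. *)

theory Defs
  imports
    "HOL-Probability.Probability"
    "HOL-Computational_Algebra.Polynomial"
    "HOL-Library.Discrete_Functions"
    "HOL-Library.FuncSet"
begin

definition log_kernel :: "real \<Rightarrow> real \<Rightarrow> ereal" where
  "log_kernel x y = (if x = y then \<infinity> else ereal (- ln \<bar>x - y\<bar>))"

text \<open>
  The double integral of the kernel, as the difference of the integrals of its positive and
  negative parts (the conversion to \<^typ>\<open>ennreal\<close> sends negative values to 0). If the measure
  is finite and carried by a compact set, the kernel is bounded below, so the second
  term is finite and the difference is a well-defined element of the half-open interval
  from minus infinity (excluded) to infinity (included).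
\<close>

definition log_energy :: "real measure \<Rightarrow> ereal" where
  "log_energy \<mu> =
     enn2ereal (\<integral>\<^sup>+x. (\<integral>\<^sup>+y. e2ennreal (log_kernel x y) \<partial>\<mu>) \<partial>\<mu>)
   - enn2ereal (\<integral>\<^sup>+x. (\<integral>\<^sup>+y. e2ennreal (- log_kernel x y) \<partial>\<mu>) \<partial>\<mu>)"

definition prob_measures_on :: "real set \<Rightarrow> real measure set" where
  "prob_measures_on K = {\<mu>. prob_space \<mu> \<and> sets \<mu> = sets borel \<and> emeasure \<mu> K = 1}"

definition robin_constant :: "real set \<Rightarrow> ereal" where
  "robin_constant K = (INF \<mu>\<in>prob_measures_on K. log_energy \<mu>)"

text \<open>
  Intended for compact \<open>K\<close>: then the Robin constant is never minus infinity, and it is infinity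
  exactly when every probability measure on \<open>K\<close> has infinite energy (or \<open>K\<close> is empty).
\<close>

definition log_capacity :: "real set \<Rightarrow> real" where
  "log_capacity K =
     (if robin_constant K = \<infinity> then 0 else exp (- real_of_ereal (robin_constant K)))"

definition is_equilibrium_measure :: "real set \<Rightarrow> real measure \<Rightarrow> bool" where
  "is_equilibrium_measure K \<mu> \<longleftrightarrow>
     \<mu> \<in> prob_measures_on K \<and> (\<forall>\<nu>\<in>prob_measures_on K. log_energy \<mu> \<le> log_energy \<nu>)"

text \<open>The parameters are \<open>\<gamma> 1, \<gamma> 2, \<dots>\<close>; the value \<open>\<gamma> 0\<close> is not used.\<close>

fun cantor_r :: "(nat \<Rightarrow> real) \<Rightarrow> nat \<Rightarrow> real" where
  "cantor_r \<gamma> 0 = 1"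
| "cantor_r \<gamma> (Suc s) = \<gamma> (Suc s) * (cantor_r \<gamma> s)\<^sup>2"

text \<open>\<open>cantor_poly \<gamma> s\<close> is the polynomial \<open>P\<close> with index \<open>2 ^ s\<close>, which has degree \<open>2 ^ s\<close>.\<close>

fun cantor_poly :: "(nat \<Rightarrow> real) \<Rightarrow> nat \<Rightarrow> real poly" where
  "cantor_poly \<gamma> 0 = [:-1, 1:]"
| "cantor_poly \<gamma> (Suc s) = cantor_poly \<gamma> s * (cantor_poly \<gamma> s + [:cantor_r \<gamma> s:])"

definition cantor_level :: "(nat \<Rightarrow> real) \<Rightarrow> nat \<Rightarrow> real set" where
  "cantor_level \<gamma> s = {x. poly (cantor_poly \<gamma> (Suc s)) x \<le> 0}"

definition cantor_set :: "(nat \<Rightarrow> real) \<Rightarrow> real set" where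
  "cantor_set \<gamma> = (\<Inter>s. cantor_level \<gamma> s)"

definition is_monic_orthogonal_poly :: "real measure \<Rightarrow> nat \<Rightarrow> real poly \<Rightarrow> bool" where
  "is_monic_orthogonal_poly \<mu> n p \<longleftrightarrow>
     degree p = n \<and> lead_coeff p = 1 \<and>
     (\<forall>q. degree q < n \<longrightarrow> (LINT x|\<mu>. poly p x * poly q x) = 0)"

text \<open>
  For \<open>n \<ge> 1\<close>, \<^term>\<open>floor_log n\<close> is the \<open>m\<close> with \<open>2 ^ m \<le> n < 2 ^ (m + 1)\<close>, and
  \<open>n div 2 ^ i mod 2\<close> is the binary digit of \<open>n\<close> at position \<open>i\<close>.
\<close>

definition binary_product :: "(nat \<Rightarrow> real poly) \<Rightarrow> nat \<Rightarrow> real poly" where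
  "binary_product Q n = (\<Prod>i\<le>floor_log n. Q (2 ^ i) ^ (n div 2 ^ i mod 2))"

end

theory Submission imports Defs begin

text \<open>
  Completing the square in the recursion for the polynomials \<open>P\<close> gives centred polynomials
  \<open>T\<^sub>s = P + r\<^sub>s / 2\<close> (where \<open>P\<close> has degree \<open>2 ^ s\<close>) with \<open>T\<^sub>s\<^sub>+\<^sub>1 = T\<^sub>s\<^sup>2 - c\<^sub>s\<close>. The set of values
  of \<open>T\<^sub>s\<close> that arises from the Cantor set is symmetric about 0, and the theorem rests on one
  analytic fact: the image of the equilibrium measure under \<open>T\<^sub>s\<close> is symmetric as well
  (lemma \<open>pushforward_symmetric\<close>). Consequently every polynomial \<open>T\<^sub>s \<cdot> h(T\<^sub>s\<^sub>+\<^sub>1)\<close>, being an odd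
  function of \<open>T\<^sub>s\<close>, has integral 0 (lemma \<open>integral_odd_eq_0\<close>).

  The symmetry is proved level by level. On a set of diameter at most 1 the logarithmic kernel is
  nonnegative, and it is a positive mixture of the kernels that say whether \<open>x\<close> and \<open>y\<close> lie in a
  common window \<open>[z - t, z]\<close> (lemma \<open>log_ker_decomposition\<close>). The energy is therefore positive
  definite: for finite energies, \<open>J(\<mu>,\<mu>) + J(\<nu>,\<nu>) \<le> 2 J(\<mu>,\<nu>)\<close> forces \<open>\<mu> = \<nu>\<close>, because the two
  measures must give equal mass to almost every window of length 1. Comparing a minimizer on a
  symmetric set with the average of the minimizer and its reflection then shows that these two are
  equal. For symmetric measures the identity \<open>ln |x - y| + ln |x + y| = ln |x\<^sup>2 - y\<^sup>2|\<close> doubles the energy under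
  \<open>x \<mapsto> x\<^sup>2 - c\<close>, so the image of the minimizer is the minimizer on the next level, and the argument
  repeats (lemmas \<open>equilibrium_measure_symmetric\<close> and \<open>equilibrium_measure_pushforward_square\<close>).
  Positive capacity enters as finiteness of the energy, which also excludes atoms.

  The rest is algebra, in the locale \<open>square_tower\<close>. The products of distinct \<open>T\<^sub>i\<close>, indexed by binary
  expansions, form a basis of the polynomials, one monic element in each degree. A product whose
  lowest factor is \<open>T\<^sub>s\<close> has the form \<open>T\<^sub>s \<cdot> h(T\<^sub>s\<^sub>+\<^sub>1)\<close>, and two products with different lowest factors
  are orthogonal (lemma \<open>tower_orthogonal\<close>). In particular \<open>T\<^sub>s\<close> is orthogonal to all polynomials
  of smaller degree, so it is the orthogonal polynomial of degree \<open>2 ^ s\<close>, and the given products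
  \<open>B\<^sub>n\<close> are the basis elements. For \<open>n = 2 ^ s (2 k + 1)\<close> split the expansion of \<open>Q\<^sub>n\<close> into the part
  \<open>u\<close> with lowest factor \<open>T\<^sub>s\<close> and the remainder \<open>v\<close>. Since \<open>B\<^sub>n\<close> belongs to \<open>u\<close>, the degree of \<open>v\<close> is
  less than \<open>n\<close>, so \<open>v\<close> is orthogonal to \<open>Q\<^sub>n\<close>; it is orthogonal to \<open>u\<close> as well, hence to itself, and
  \<open>v = 0\<close>. Uniqueness of the coefficients holds because the \<open>B\<^sub>n\<close> have distinct degrees.
\<close>

section \<open>The logarithmic kernel as a mixture of windows\<close>

text \<open>
  The energy is used below only for measures on sets of diameter at most 1. There the kernel is
  nonnegative, and values in \<^typ>\<open>ennreal\<close> make Fubini's theorem free of integrability conditions.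
\<close>

definition log_ker :: "real \<Rightarrow> real \<Rightarrow> ennreal" where
  "log_ker x y = e2ennreal (log_kernel x y)"

definition mutual_energy :: "real measure \<Rightarrow> real measure \<Rightarrow> ennreal" where
  "mutual_energy \<mu> \<nu> = (\<integral>\<^sup>+x. (\<integral>\<^sup>+y. log_ker x y \<partial>\<nu>) \<partial>\<mu>)"

lemma log_ker_measurable [measurable (raw)]:
  assumes [measurable]: "f \<in> borel_measurable M" "g \<in> borel_measurable M"
  shows "(\<lambda>x. log_ker (f x) (g x)) \<in> borel_measurable M"
  unfolding log_ker_def log_kernel_def by measurable

lemma log_ker_refl: "log_ker x x = \<infinity>"
  by (simp add: log_ker_def log_kernel_def)

lemma log_ker_neq: "x \<noteq> y \<Longrightarrow> log_ker x y = ennreal (- ln \<bar>x - y\<bar>)"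
  by (simp add: log_ker_def log_kernel_def)

text \<open>
  The number \<open>z\<close> lies in \<open>{x..x+t}\<close> exactly if \<open>x\<close> lies in the window \<open>{z-t..z}\<close>. So this is the measure
  of the set of windows of length \<open>t\<close> that contain both points.
\<close>

lemma overlap_length:
  fixes x y t :: real
  assumes "t \<ge> 0"
  shows "(\<integral>\<^sup>+z. indicator {x..x+t} z * indicator {y..y+t} z \<partial>lborel) = ennreal (t - \<bar>x - y\<bar>)"
proof -
  have "(\<integral>\<^sup>+z. indicator {x..x+t} z * indicator {y..y+t} z \<partial>lborel)
      = (\<integral>\<^sup>+z. indicator {max x y..min x y + t} z \<partial>lborel)"
    by (intro nn_integral_cong) (auto simp: indicator_def)
  also have "\<dots> = emeasure lborel {max x y..min x y + t}"
    by simp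
  also have "\<dots> = ennreal (t - \<bar>x - y\<bar>)"
  proof (cases "max x y \<le> min x y + t")
    case True
    then show ?thesis by (simp add: emeasure_lborel_Icc_eq max_def min_def abs_if split: if_splits)
  next
    case False
    then have "t - \<bar>x - y\<bar> \<le> 0" by (auto simp: max_def min_def abs_if split: if_splits)
    then show ?thesis using False by (simp add: ennreal_neg)
  qed
  finally show ?thesis .
qed

text \<open>
  The density of window lengths. A window kernel has the second derivative in \<open>\<bar>x - y\<bar>\<close> concentrated at
  its length, and the second derivative of \<open>- ln u\<close> is \<open>1 / u\<^sup>2\<close>.
\<close>

definition scale_weight :: "real \<Rightarrow> ennreal" where
  "scale_weight t = ennreal (1 / t\<^sup>2) * indicator {0<..1} t"

lemma scale_weight_measurable [measurable]: "scale_weight \<in> borel_measurable borel"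
  unfolding scale_weight_def by measurable

lemma hat_integral_pos:
  fixes u :: real
  assumes "0 < u" "u \<le> 1"
  shows "(\<integral>\<^sup>+t. scale_weight t * ennreal (t - u) \<partial>lborel) = ennreal (- ln u - (1 - u))"
proof -
  have "(\<integral>\<^sup>+t. scale_weight t * ennreal (t - u) \<partial>lborel)
      = (\<integral>\<^sup>+t. ennreal (1 / t - u / t\<^sup>2) * indicator {u..1} t \<partial>lborel)"
  proof (intro nn_integral_cong)
    fix t :: real
    show "scale_weight t * ennreal (t - u) = ennreal (1 / t - u / t\<^sup>2) * indicator {u..1} t"
    proof (cases "u \<le> t \<and> t \<le> 1")
      case True
      then have "1 / t\<^sup>2 * (t - u) = 1 / t - u / t\<^sup>2"
        using assms by (simp add: field_simps power2_eq_square)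
      then show ?thesis
        using True assms by (simp add: scale_weight_def ennreal_mult[symmetric] del: times_divide_eq_left)
    next
      case False
      then show ?thesis
        by (auto simp: scale_weight_def indicator_def ennreal_neg)
    qed
  qed
  also have "\<dots> = ennreal ((ln 1 + u / 1) - (ln u + u / u))"
  proof (rule nn_integral_FTC_Icc)
    fix t assume t: "t \<in> {u..1}"
    then have "t > 0" using assms by auto
    then show "((\<lambda>t. ln t + u / t) has_real_derivative 1 / t - u / t\<^sup>2) (at t)"
      by (auto intro!: derivative_eq_intros simp: power2_eq_square divide_inverse)
    have "u / t\<^sup>2 \<le> t / t\<^sup>2" using t \<open>t > 0\<close> by (intro divide_right_mono) auto
    then show "0 \<le> 1 / t - u / t\<^sup>2" using \<open>t > 0\<close> by (simp add: power2_eq_square)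
  qed (use assms in auto)
  finally show ?thesis using assms by (simp add: algebra_simps)
qed

text \<open>
  For \<open>u = \<bar>x - y\<bar> \<le> 1\<close> the integral over the scales is \<open>- ln u - (1 - u)\<close>, and \<open>1 - u\<close> is itself the
  window kernel of length 1. All the weights are positive, which makes the kernel positive definite;
  the separate term of length 1 is what later identifies the measures.
\<close>

lemma log_ker_decomposition:
  assumes "\<bar>x - y\<bar> \<le> 1"
  shows "log_ker x y =
    (\<integral>\<^sup>+t. scale_weight t * ennreal (t - \<bar>x - y\<bar>) \<partial>lborel) + ennreal (1 - \<bar>x - y\<bar>)"
proof (cases "x = y")
  case False
  define u where "u = \<bar>x - y\<bar>"
  have u: "0 < u" "u \<le> 1" using assms False by (auto simp: u_def)
  have "ln u \<le> u - 1" using u by (intro ln_le_minus_one)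
  then have "ennreal (- ln u) = ennreal (- ln u - (1 - u)) + ennreal (1 - u)"
    using u by (simp add: ennreal_plus[symmetric] del: ennreal_plus)
  then show ?thesis
    using hat_integral_pos[OF u] False by (simp add: log_ker_neq u_def)
next
  case True
  \<comment> \<open>On the diagonal the integral dominates its value at every positive distance \<open>u\<close>, which is
    at least \<open>- ln u - 1\<close>.\<close>
  have "ennreal (real n) \<le> (\<integral>\<^sup>+t. scale_weight t * ennreal t \<partial>lborel)" for n
  proof -
    define u where "u = exp (- real n - 1)"
    have u: "0 < u" "u \<le> 1" by (auto simp: u_def)
    have "ennreal (real n) \<le> ennreal (- ln u - (1 - u))"
      using u by (intro ennreal_leI) (simp add: u_def)
    also have "\<dots> = (\<integral>\<^sup>+t. scale_weight t * ennreal (t - u) \<partial>lborel)"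
      using hat_integral_pos[OF u] by simp
    also have "\<dots> \<le> (\<integral>\<^sup>+t. scale_weight t * ennreal t \<partial>lborel)"
      using u by (intro nn_integral_mono mult_left_mono ennreal_leI) auto
    finally show ?thesis .
  qed
  then have "(\<integral>\<^sup>+t. scale_weight t * ennreal t \<partial>lborel) = \<infinity>"
    by (metis ennreal_of_nat_eq_real_of_nat ennreal_Ex_less_of_nat infinity_ennreal_def
        less_top linorder_not_less)
  then show ?thesis using True by (simp add: log_ker_refl)
qed

definition window_energy :: "real \<Rightarrow> real measure \<Rightarrow> real measure \<Rightarrow> ennreal" where
  "window_energy t \<mu> \<nu> = (\<integral>\<^sup>+z. emeasure \<mu> {z-t..z} * emeasure \<nu> {z-t..z} \<partial>lborel)"

lemma window_energy_eq:
  assumes "prob_space \<mu>" "sets \<mu> = sets borel" "prob_space \<nu>" "sets \<nu> = sets borel" "t \<ge> 0"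
  shows "(\<integral>\<^sup>+x. (\<integral>\<^sup>+y. ennreal (t - \<bar>x - y\<bar>) \<partial>\<nu>) \<partial>\<mu>) = window_energy t \<mu> \<nu>"
proof -
  interpret M: prob_space \<mu> by fact
  interpret N: prob_space \<nu> by fact
  note [measurable_cong] = assms(2,4)
  interpret P1: pair_sigma_finite \<nu> lborel by unfold_locales
  interpret P2: pair_sigma_finite \<mu> lborel by unfold_locales
  have ind: "(\<lambda>p. indicator {fst p..fst p + t} (snd p) :: ennreal) \<in> borel_measurable (borel \<Otimes>\<^sub>M borel)"
    (is "?f \<in> _") for t :: real
  proof -
    have "?f = indicator {p. fst p \<le> snd p \<and> snd p \<le> fst p + t}"
      by (auto simp: indicator_def fun_eq_iff)
    then show ?thesis by simp
  qed
  have [measurable]: "(\<lambda>(x, z). indicator {x..x + t} z :: ennreal) \<in> borel_measurable (borel \<Otimes>\<^sub>M borel)"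
    using ind by (simp add: case_prod_beta)
  have "(\<integral>\<^sup>+x. (\<integral>\<^sup>+y. ennreal (t - \<bar>x - y\<bar>) \<partial>\<nu>) \<partial>\<mu>)
     = (\<integral>\<^sup>+x. (\<integral>\<^sup>+y. (\<integral>\<^sup>+z. indicator {x..x+t} z * indicator {y..y+t} z \<partial>lborel) \<partial>\<nu>) \<partial>\<mu>)"
    using assms(5) by (simp add: overlap_length)
  also have "\<dots> = (\<integral>\<^sup>+x. (\<integral>\<^sup>+z. (\<integral>\<^sup>+y. indicator {x..x+t} z * indicator {y..y+t} z \<partial>\<nu>) \<partial>lborel) \<partial>\<mu>)"
    by (intro nn_integral_cong P1.Fubini'[symmetric]) measurable
  also have "\<dots> = (\<integral>\<^sup>+x. (\<integral>\<^sup>+z. indicator {x..x+t} z * (\<integral>\<^sup>+y. indicator {y..y+t} z \<partial>\<nu>) \<partial>lborel) \<partial>\<mu>)"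
    by (intro nn_integral_cong nn_integral_cmult) measurable
  also have "\<dots> = (\<integral>\<^sup>+z. (\<integral>\<^sup>+x. indicator {x..x+t} z * (\<integral>\<^sup>+y. indicator {y..y+t} z \<partial>\<nu>) \<partial>\<mu>) \<partial>lborel)"
    by (intro P2.Fubini'[symmetric]) measurable
  also have "\<dots> = (\<integral>\<^sup>+z. (\<integral>\<^sup>+x. indicator {x..x+t} z \<partial>\<mu>) * (\<integral>\<^sup>+y. indicator {y..y+t} z \<partial>\<nu>) \<partial>lborel)"
    by (intro nn_integral_cong nn_integral_multc) measurable
  also have "\<dots> = window_energy t \<mu> \<nu>"
  proof -
    have "(\<integral>\<^sup>+x. indicator {x..x+t} z \<partial>M) = emeasure M {z-t..z}" if "sets M = sets borel" for M :: "real measure" and z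
    proof -
      have "(\<integral>\<^sup>+x. indicator {x..x+t} z \<partial>M) = (\<integral>\<^sup>+x. indicator {z-t..z} x \<partial>M)"
        by (intro nn_integral_cong) (auto simp: indicator_def)
      then show ?thesis using that by simp
    qed
    then show ?thesis using assms by (simp add: window_energy_def)
  qed
  finally show ?thesis .
qed

lemma mutual_energy_windows:
  assumes M: "prob_space \<mu>" "sets \<mu> = sets borel" and N: "prob_space \<nu>" "sets \<nu> = sets borel"
    and "AE x in \<mu>. \<bar>x\<bar> \<le> 1 / 2" "AE x in \<nu>. \<bar>x\<bar> \<le> 1 / 2"
  shows "mutual_energy \<mu> \<nu> = (\<integral>\<^sup>+t. scale_weight t * window_energy t \<mu> \<nu> \<partial>lborel) + window_energy 1 \<mu> \<nu>"
proof -
  interpret M: prob_space \<mu> by fact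
  interpret N: prob_space \<nu> by fact
  note [measurable_cong] = M(2) N(2)
  interpret P1: pair_sigma_finite \<nu> lborel by unfold_locales
  interpret P2: pair_sigma_finite \<mu> lborel by unfold_locales
  have "mutual_energy \<mu> \<nu> = (\<integral>\<^sup>+x. (\<integral>\<^sup>+y. (\<integral>\<^sup>+t. scale_weight t * ennreal (t - \<bar>x - y\<bar>) \<partial>lborel)
        + ennreal (1 - \<bar>x - y\<bar>) \<partial>\<nu>) \<partial>\<mu>)"
    unfolding mutual_energy_def
  proof (rule nn_integral_cong_AE, use assms(5) in eventually_elim)
    fix x :: real assume x: "\<bar>x\<bar> \<le> 1 / 2"
    show "(\<integral>\<^sup>+y. log_ker x y \<partial>\<nu>) = (\<integral>\<^sup>+y. (\<integral>\<^sup>+t. scale_weight t * ennreal (t - \<bar>x - y\<bar>) \<partial>lborel)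
        + ennreal (1 - \<bar>x - y\<bar>) \<partial>\<nu>)"
    proof (rule nn_integral_cong_AE, use assms(6) in eventually_elim)
      fix y :: real assume "\<bar>y\<bar> \<le> 1 / 2"
      then show "log_ker x y = (\<integral>\<^sup>+t. scale_weight t * ennreal (t - \<bar>x - y\<bar>) \<partial>lborel)
        + ennreal (1 - \<bar>x - y\<bar>)"
        using x by (intro log_ker_decomposition) linarith
    qed
  qed
  also have "\<dots> = (\<integral>\<^sup>+x. (\<integral>\<^sup>+y. (\<integral>\<^sup>+t. scale_weight t * ennreal (t - \<bar>x - y\<bar>) \<partial>lborel) \<partial>\<nu>)
        + (\<integral>\<^sup>+y. ennreal (1 - \<bar>x - y\<bar>) \<partial>\<nu>) \<partial>\<mu>)"
    by (intro nn_integral_cong nn_integral_add) measurable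
  also have "\<dots> = (\<integral>\<^sup>+x. (\<integral>\<^sup>+y. (\<integral>\<^sup>+t. scale_weight t * ennreal (t - \<bar>x - y\<bar>) \<partial>lborel) \<partial>\<nu>) \<partial>\<mu>)
        + (\<integral>\<^sup>+x. (\<integral>\<^sup>+y. ennreal (1 - \<bar>x - y\<bar>) \<partial>\<nu>) \<partial>\<mu>)"
    by (intro nn_integral_add) measurable
  also have "(\<integral>\<^sup>+x. (\<integral>\<^sup>+y. (\<integral>\<^sup>+t. scale_weight t * ennreal (t - \<bar>x - y\<bar>) \<partial>lborel) \<partial>\<nu>) \<partial>\<mu>)
     = (\<integral>\<^sup>+x. (\<integral>\<^sup>+t. (\<integral>\<^sup>+y. scale_weight t * ennreal (t - \<bar>x - y\<bar>) \<partial>\<nu>) \<partial>lborel) \<partial>\<mu>)"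
    by (intro nn_integral_cong P1.Fubini'[symmetric]) measurable
  also have "\<dots> = (\<integral>\<^sup>+t. (\<integral>\<^sup>+x. (\<integral>\<^sup>+y. scale_weight t * ennreal (t - \<bar>x - y\<bar>) \<partial>\<nu>) \<partial>\<mu>) \<partial>lborel)"
    by (intro P2.Fubini'[symmetric]) measurable
  also have "\<dots> = (\<integral>\<^sup>+t. scale_weight t * (\<integral>\<^sup>+x. (\<integral>\<^sup>+y. ennreal (t - \<bar>x - y\<bar>) \<partial>\<nu>) \<partial>\<mu>) \<partial>lborel)"
    by (simp add: nn_integral_cmult)
  also have "\<dots> = (\<integral>\<^sup>+t. scale_weight t * window_energy t \<mu> \<nu> \<partial>lborel)"
    by (intro nn_integral_cong)
      (auto simp: scale_weight_def indicator_def window_energy_eq[OF M N])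
  also have "(\<integral>\<^sup>+x. (\<integral>\<^sup>+y. ennreal (1 - \<bar>x - y\<bar>) \<partial>\<nu>) \<partial>\<mu>) = window_energy 1 \<mu> \<nu>"
    by (rule window_energy_eq[OF M N]) simp
  finally show ?thesis .
qed

section \<open>Positive definiteness of the energy\<close>

lemma emeasure_am_gm:
  "2 * (emeasure \<mu> A * emeasure \<nu> A) \<le> emeasure \<mu> A * emeasure \<mu> A + emeasure \<nu> A * emeasure \<nu> A"
  if "finite_measure \<mu>" "finite_measure \<nu>"
proof -
  interpret M: finite_measure \<mu> by fact
  interpret N: finite_measure \<nu> by fact
  have "2 * (measure \<mu> A * measure \<nu> A) \<le> measure \<mu> A * measure \<mu> A + measure \<nu> A * measure \<nu> A"
    using sum_squares_bound[of "measure \<mu> A" "measure \<nu> A"] by (simp add: power2_eq_square)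
  then have "ennreal (2 * (measure \<mu> A * measure \<nu> A))
    \<le> ennreal (measure \<mu> A * measure \<mu> A + measure \<nu> A * measure \<nu> A)"
    by (rule ennreal_leI)
  then show ?thesis
    unfolding M.emeasure_eq_measure N.emeasure_eq_measure
    by (simp add: ennreal_mult)
qed

lemma window_mass_measurable:
  assumes "finite_measure \<mu>" "sets \<mu> = sets borel"
  shows "(\<lambda>z::real. emeasure \<mu> {z-t..z}) \<in> borel_measurable borel"
proof -
  interpret M: finite_measure \<mu> by fact
  note [measurable_cong] = assms(2)
  have "(\<lambda>z. emeasure \<mu> (Pair z -` {p :: real \<times> real. fst p - t \<le> snd p \<and> snd p \<le> fst p})) \<in> borel_measurable borel"
  proof (rule M.measurable_emeasure_Pair)
    have "{p \<in> space (borel \<Otimes>\<^sub>M borel). fst p - t \<le> snd p \<and> snd p \<le> (fst (p :: real \<times> real))}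
        \<in> sets (borel \<Otimes>\<^sub>M borel)"
      by measurable
    then show "{p :: real \<times> real. fst p - t \<le> snd p \<and> snd p \<le> fst p} \<in> sets (borel \<Otimes>\<^sub>M \<mu>)"
      by (simp add: space_pair_measure sets_pair_measure_cong[OF refl assms(2)])
  qed
  moreover have "Pair z -` {p :: real \<times> real. fst p - t \<le> snd p \<and> snd p \<le> fst p} = {z-t..z}" for z
    by auto
  ultimately show ?thesis by simp
qed

lemma window_energy_am_gm:
  assumes "prob_space \<mu>" "sets \<mu> = sets borel" "prob_space \<nu>" "sets \<nu> = sets borel"
  shows "2 * window_energy t \<mu> \<nu> \<le> window_energy t \<mu> \<mu> + window_energy t \<nu> \<nu>"
proof -
  have fin: "finite_measure \<mu>" "finite_measure \<nu>"
    using assms by (auto simp: prob_space.finite_measure)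
  note [measurable] = window_mass_measurable[OF fin(1) assms(2)] window_mass_measurable[OF fin(2) assms(4)]
  have "2 * window_energy t \<mu> \<nu> = (\<integral>\<^sup>+z. 2 * (emeasure \<mu> {z-t..z} * emeasure \<nu> {z-t..z}) \<partial>lborel)"
    unfolding window_energy_def by (rule nn_integral_cmult[symmetric]) measurable
  also have "\<dots> \<le> (\<integral>\<^sup>+z. emeasure \<mu> {z-t..z} * emeasure \<mu> {z-t..z}
      + emeasure \<nu> {z-t..z} * emeasure \<nu> {z-t..z} \<partial>lborel)"
    by (intro nn_integral_mono emeasure_am_gm fin)
  also have "\<dots> = window_energy t \<mu> \<mu> + window_energy t \<nu> \<nu>"
    unfolding window_energy_def by (rule nn_integral_add) measurable
  finally show ?thesis .
qed

lemma window_energy_measurable: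
  assumes "prob_space \<mu>" "sets \<mu> = sets borel" "prob_space \<nu>" "sets \<nu> = sets borel"
  shows "(\<lambda>t. scale_weight t * window_energy t \<mu> \<nu>) \<in> borel_measurable borel"
proof -
  interpret M: prob_space \<mu> by fact
  interpret N: prob_space \<nu> by fact
  note [measurable_cong] = assms(2,4)
  have "(\<lambda>t. scale_weight t * window_energy t \<mu> \<nu>)
    = (\<lambda>t. scale_weight t * (\<integral>\<^sup>+x. (\<integral>\<^sup>+y. ennreal (t - \<bar>x - y\<bar>) \<partial>\<nu>) \<partial>\<mu>))"
    by (intro ext) (auto simp: scale_weight_def indicator_def window_energy_eq[OF assms])
  also have "\<dots> \<in> borel_measurable borel" by measurable
  finally show ?thesis .
qed

text \<open>
  Each scale contributes to \<open>J(\<mu>,\<mu>) + J(\<nu>,\<nu>) - 2 J(\<mu>,\<nu>)\<close> the integral of a square. Of these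
  contributions only the one of length 1 is kept; the statement avoids subtraction because the
  terms may be infinite.
\<close>

lemma mutual_energy_window_gap:
  assumes M: "prob_space \<mu>" "sets \<mu> = sets borel" and N: "prob_space \<nu>" "sets \<nu> = sets borel"
    and b: "AE x in \<mu>. \<bar>x\<bar> \<le> 1 / 2" "AE x in \<nu>. \<bar>x\<bar> \<le> 1 / 2"
  shows "2 * mutual_energy \<mu> \<nu> + (window_energy 1 \<mu> \<mu> + window_energy 1 \<nu> \<nu>)
    \<le> mutual_energy \<mu> \<mu> + mutual_energy \<nu> \<nu> + 2 * window_energy 1 \<mu> \<nu>"
proof -
  note [measurable] = window_energy_measurable[OF M N] window_energy_measurable[OF M M]
    window_energy_measurable[OF N N]
  have "2 * (\<integral>\<^sup>+t. scale_weight t * window_energy t \<mu> \<nu> \<partial>lborel)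
      = (\<integral>\<^sup>+t. 2 * (scale_weight t * window_energy t \<mu> \<nu>) \<partial>lborel)"
    by (rule nn_integral_cmult[symmetric]) measurable
  also have "\<dots> \<le> (\<integral>\<^sup>+t. scale_weight t * window_energy t \<mu> \<mu> + scale_weight t * window_energy t \<nu> \<nu> \<partial>lborel)"
  proof (rule nn_integral_mono)
    fix t
    show "2 * (scale_weight t * window_energy t \<mu> \<nu>)
      \<le> scale_weight t * window_energy t \<mu> \<mu> + scale_weight t * window_energy t \<nu> \<nu>"
      using mult_left_mono[OF window_energy_am_gm[OF M N, of t], of "scale_weight t"]
      by (simp add: algebra_simps)
  qed
  also have "\<dots> = (\<integral>\<^sup>+t. scale_weight t * window_energy t \<mu> \<mu> \<partial>lborel)
      + (\<integral>\<^sup>+t. scale_weight t * window_energy t \<nu> \<nu> \<partial>lborel)"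
    by (rule nn_integral_add) measurable
  finally have *: "2 * (\<integral>\<^sup>+t. scale_weight t * window_energy t \<mu> \<nu> \<partial>lborel)
    \<le> (\<integral>\<^sup>+t. scale_weight t * window_energy t \<mu> \<mu> \<partial>lborel)
      + (\<integral>\<^sup>+t. scale_weight t * window_energy t \<nu> \<nu> \<partial>lborel)" .
  show ?thesis
    unfolding mutual_energy_windows[OF M N b] mutual_energy_windows[OF M M b(1) b(1)]
      mutual_energy_windows[OF N N b(2) b(2)]
    using add_right_mono[OF *, of "2 * window_energy 1 \<mu> \<nu> + (window_energy 1 \<mu> \<mu> + window_energy 1 \<nu> \<nu>)"]
    by (simp add: algebra_simps)
qed

lemma window_energy_1_le_1:
  assumes M: "prob_space \<mu>" "sets \<mu> = sets borel" and N: "prob_space \<nu>" "sets \<nu> = sets borel"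
  shows "window_energy 1 \<mu> \<nu> \<le> 1"
proof -
  interpret M: prob_space \<mu> by fact
  interpret N: prob_space \<nu> by fact
  have "(\<integral>\<^sup>+x. (\<integral>\<^sup>+y. ennreal (1 - \<bar>x - y\<bar>) \<partial>\<nu>) \<partial>\<mu>) \<le> (\<integral>\<^sup>+x. (\<integral>\<^sup>+y. 1 \<partial>\<nu>) \<partial>\<mu>)"
    by (intro nn_integral_mono) (auto simp: ennreal_le_1)
  then show ?thesis
    by (simp add: window_energy_eq[OF M N] M.emeasure_space_1 N.emeasure_space_1)
qed

text \<open>
  The difference of the two sides of the hypothesis is the integral of the squared difference of the
  window masses.
\<close>

lemma AE_equal_window_masses:
  assumes M: "prob_space \<mu>" "sets \<mu> = sets borel" and N: "prob_space \<nu>" "sets \<nu> = sets borel"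
    and le: "window_energy 1 \<mu> \<mu> + window_energy 1 \<nu> \<nu> \<le> 2 * window_energy 1 \<mu> \<nu>"
  shows "AE z in lborel. measure \<mu> {z-1..z} = measure \<nu> {z-1..z}"
proof -
  interpret M: prob_space \<mu> by fact
  interpret N: prob_space \<nu> by fact
  note [measurable] = window_mass_measurable[OF M.finite_measure_axioms M(2)]
    window_mass_measurable[OF N.finite_measure_axioms N(2)]
  define a b where "a z = measure \<mu> {z-1..z}" and "b z = measure \<nu> {z-1..z}" for z
  have a: "emeasure \<mu> {z-1..z} = ennreal (a z)" and b: "emeasure \<nu> {z-1..z} = ennreal (b z)" for z
    by (simp_all add: a_def b_def M.emeasure_eq_measure N.emeasure_eq_measure)
  have [simp]: "a z \<ge> 0" "b z \<ge> 0" for z by (simp_all add: a_def b_def)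
  have [measurable]: "a \<in> borel_measurable borel" "b \<in> borel_measurable borel"
    unfolding a_def b_def measure_def by measurable
  let ?d = "\<integral>\<^sup>+z. ennreal ((a z - b z)\<^sup>2) \<partial>lborel"
  have "window_energy 1 \<mu> \<mu> + window_energy 1 \<nu> \<nu> =
     (\<integral>\<^sup>+z. ennreal (a z) * ennreal (a z) + ennreal (b z) * ennreal (b z) \<partial>lborel)"
    unfolding window_energy_def a b by (rule nn_integral_add[symmetric]) measurable
  also have "\<dots> = (\<integral>\<^sup>+z. 2 * (ennreal (a z) * ennreal (b z)) + ennreal ((a z - b z)\<^sup>2) \<partial>lborel)"
  proof (rule nn_integral_cong)
    fix z
    have "ennreal (a z * a z + b z * b z) = ennreal (2 * (a z * b z) + (a z - b z)\<^sup>2)"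
      by (simp add: power2_eq_square algebra_simps)
    then show "ennreal (a z) * ennreal (a z) + ennreal (b z) * ennreal (b z)
      = 2 * (ennreal (a z) * ennreal (b z)) + ennreal ((a z - b z)\<^sup>2)"
      by (simp add: ennreal_mult)
  qed
  also have "\<dots> = (\<integral>\<^sup>+z. 2 * (ennreal (a z) * ennreal (b z)) \<partial>lborel) + ?d"
    by (rule nn_integral_add) measurable
  also have "(\<integral>\<^sup>+z. 2 * (ennreal (a z) * ennreal (b z)) \<partial>lborel) = 2 * window_energy 1 \<mu> \<nu>"
    unfolding window_energy_def a b by (rule nn_integral_cmult) measurable
  finally have "2 * window_energy 1 \<mu> \<nu> + ?d \<le> 2 * window_energy 1 \<mu> \<nu> + 0"
    using le by simp
  moreover have "window_energy 1 \<mu> \<nu> \<noteq> \<top>"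
    using window_energy_1_le_1[OF M N] by (auto simp: top_unique)
  ultimately have "?d = 0"
    by (subst (asm) ennreal_add_left_cancel_le) (auto simp: ennreal_mult_eq_top_iff)
  then have "AE z in lborel. ennreal ((a z - b z)\<^sup>2) = 0"
    by (subst (asm) nn_integral_0_iff_AE) auto
  then show ?thesis
    by eventually_elim (simp add: a_def b_def ennreal_eq_0_iff)
qed

text \<open>
  On measures carried by \<open>{-1/2..1/2}\<close>, a window of length 1 ending at \<open>z < 1/2\<close> has the mass of the
  half-line up to \<open>z\<close>. So almost all values of the distribution functions agree, and right
  continuity gives the others.
\<close>

lemma measure_eqI_windows:
  fixes \<mu> \<nu> :: "real measure"
  assumes M: "prob_space \<mu>" "sets \<mu> = sets borel" and N: "prob_space \<nu>" "sets \<nu> = sets borel"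
    and b: "AE x in \<mu>. \<bar>x\<bar> \<le> 1 / 2" "AE x in \<nu>. \<bar>x\<bar> \<le> 1 / 2"
    and eq: "AE z in lborel. measure \<mu> {z-1..z} = measure \<nu> {z-1..z}"
  shows "\<mu> = \<nu>"
proof -
  interpret M: prob_space \<mu> by fact
  interpret N: prob_space \<nu> by fact
  interpret RM: real_distribution \<mu> using M(2) by unfold_locales simp
  interpret RN: real_distribution \<nu> using N(2) by unfold_locales simp
  have win: "measure \<rho> {z-1..z} = cdf \<rho> z"
    if "prob_space \<rho>" "sets \<rho> = sets borel" "AE x in \<rho>. \<bar>x\<bar> \<le> 1 / 2" "z < 1 / 2" for \<rho> :: "real measure" and z :: real
  proof -
    interpret R: prob_space \<rho> by fact
    note [measurable_cong] = that(2)
    show ?thesis unfolding cdf_def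
      by (rule R.finite_measure_eq_AE) (use that in \<open>auto elim!: eventually_mono\<close>)
  qed
  have one: "cdf \<rho> z = 1"
    if "prob_space \<rho>" "sets \<rho> = sets borel" "AE x in \<rho>. \<bar>x\<bar> \<le> 1 / 2" "z \<ge> 1 / 2" for \<rho> :: "real measure" and z :: real
  proof -
    interpret R: prob_space \<rho> by fact
    show ?thesis unfolding cdf_def
      by (subst R.prob_eq_1) (use that in \<open>auto elim!: eventually_mono\<close>)
  qed
  have "cdf \<mu> x = cdf \<nu> x" for x
  proof (cases "x < 1 / 2")
    case False
    then show ?thesis using one M N b by simp
  next
    case x: True
    show ?thesis
    proof (rule ccontr)
      assume neq: "cdf \<mu> x \<noteq> cdf \<nu> x"
      have "((\<lambda>z. cdf \<mu> z - cdf \<nu> z) \<longlongrightarrow> cdf \<mu> x - cdf \<nu> x) (at_right x)"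
        using RM.cdf_is_right_cont[of x] RN.cdf_is_right_cont[of x]
        unfolding continuous_within by (rule tendsto_diff)
      then have "eventually (\<lambda>z. cdf \<mu> z - cdf \<nu> z \<noteq> 0) (at_right x)"
        using neq by (intro tendsto_imp_eventually_ne) auto
      moreover have "eventually (\<lambda>z. z < 1 / 2) (at_right x)"
        using x eventually_at_right_real[OF x] by (auto elim: eventually_mono)
      ultimately have "eventually (\<lambda>z. cdf \<mu> z \<noteq> cdf \<nu> z \<and> z < 1 / 2) (at_right x)"
        by eventually_elim auto
      then obtain e where e: "e > x" "\<And>z. x < z \<Longrightarrow> z < e \<Longrightarrow> cdf \<mu> z \<noteq> cdf \<nu> z \<and> z < 1 / 2"
        unfolding eventually_at_right_field by auto
      from eq have "AE z in lborel. z \<notin> {x<..<e}"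
      proof eventually_elim
        case (elim z)
        then show ?case
          using e(2)[of z] win[OF M b(1), of z] win[OF N b(2), of z] by auto
      qed
      then have "emeasure lborel {x<..<e} = 0"
        by (subst (asm) AE_iff_measurable[OF _ refl]) (auto simp: greaterThanLessThan_def greaterThan_def lessThan_def Int_def)
      then show False using e(1) by simp
    qed
  qed
  then show ?thesis by (intro cdf_unique) (auto simp: RM.real_distribution_axioms RN.real_distribution_axioms fun_eq_iff)
qed

text \<open>
  Strict positive definiteness: the last hypothesis says formally that \<open>\<mu> - \<nu>\<close> has energy at most 0.
  Finiteness allows the energies to be cancelled.
\<close>

lemma measure_eq_of_mutual_energy:
  assumes M: "prob_space \<mu>" "sets \<mu> = sets borel" and N: "prob_space \<nu>" "sets \<nu> = sets borel"
    and b: "AE x in \<mu>. \<bar>x\<bar> \<le> 1 / 2" "AE x in \<nu>. \<bar>x\<bar> \<le> 1 / 2"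
    and fin: "mutual_energy \<mu> \<mu> < \<infinity>" "mutual_energy \<nu> \<nu> < \<infinity>"
    and le: "mutual_energy \<mu> \<mu> + mutual_energy \<nu> \<nu> \<le> 2 * mutual_energy \<mu> \<nu>"
  shows "\<mu> = \<nu>"
proof -
  let ?E = "mutual_energy \<mu> \<mu> + mutual_energy \<nu> \<nu>"
  have "?E + (window_energy 1 \<mu> \<mu> + window_energy 1 \<nu> \<nu>)
    \<le> 2 * mutual_energy \<mu> \<nu> + (window_energy 1 \<mu> \<mu> + window_energy 1 \<nu> \<nu>)"
    using le by (rule add_right_mono)
  also have "\<dots> \<le> ?E + 2 * window_energy 1 \<mu> \<nu>"
    by (rule mutual_energy_window_gap[OF M N b])
  finally have "window_energy 1 \<mu> \<mu> + window_energy 1 \<nu> \<nu> \<le> 2 * window_energy 1 \<mu> \<nu>"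
    using fin by (subst (asm) ennreal_add_left_cancel_le) (auto simp: less_top)
  then show ?thesis
    by (intro measure_eqI_windows[OF M N b] AE_equal_window_masses[OF M N])
qed

section \<open>Symmetrization\<close>

lemma prob_measures_onD:
  assumes "\<mu> \<in> prob_measures_on S"
  shows "prob_space \<mu>" "sets \<mu> = sets borel" "S \<in> sets borel \<Longrightarrow> AE x in \<mu>. x \<in> S"
proof -
  show p: "prob_space \<mu>" "sets \<mu> = sets borel"
    using assms by (auto simp: prob_measures_on_def)
  interpret prob_space \<mu> by fact
  show "AE x in \<mu>. x \<in> S" if "S \<in> sets borel"
    using assms that p by (subst prob_eq_1[symmetric]) (auto simp: prob_measures_on_def emeasure_eq_measure)
qed

lemma prob_measures_onI:
  assumes "prob_space \<mu>" "sets \<mu> = sets borel" "S \<in> sets borel" "AE x in \<mu>. x \<in> S"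
  shows "\<mu> \<in> prob_measures_on S"
proof -
  interpret prob_space \<mu> by fact
  show ?thesis
    using assms prob_eq_1[of S] by (auto simp: prob_measures_on_def emeasure_eq_measure)
qed

lemma distr_prob_measures_on:
  assumes \<mu>: "\<mu> \<in> prob_measures_on S" and [measurable]: "S \<in> sets borel" "S' \<in> sets borel" "f \<in> borel_measurable borel"
    and "\<And>x. x \<in> S \<Longrightarrow> f x \<in> S'"
  shows "distr \<mu> borel f \<in> prob_measures_on S'"
proof -
  interpret prob_space \<mu> by (rule prob_measures_onD[OF \<mu>])
  note [measurable_cong] = prob_measures_onD(2)[OF \<mu>]
  show ?thesis
  proof (rule prob_measures_onI)
    show "prob_space (distr \<mu> borel f)" by (rule prob_space_distr) measurable
    show "AE x in distr \<mu> borel f. x \<in> S'"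
      using prob_measures_onD(3)[OF \<mu>] assms by (subst AE_distr_iff) (auto elim!: eventually_mono)
  qed auto
qed

lemma abs_le_half: "S \<subseteq> {- 1 / 2..1 / 2} \<Longrightarrow> x \<in> S \<Longrightarrow> \<bar>x\<bar> \<le> (1 / 2 :: real)"
  by (force simp: abs_le_iff)

lemma log_kernel_nonneg: "\<bar>x - y\<bar> \<le> 1 \<Longrightarrow> 0 \<le> log_kernel x y"
  by (auto simp: log_kernel_def)

lemma log_energy_eq_mutual_energy:
  assumes \<mu>: "\<mu> \<in> prob_measures_on S" and S: "S \<in> sets borel" "S \<subseteq> {- 1 / 2..1 / 2}"
  shows "log_energy \<mu> = enn2ereal (mutual_energy \<mu> \<mu>)"
proof -
  interpret prob_space \<mu> by (rule prob_measures_onD[OF \<mu>])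
  note AE = prob_measures_onD(3)[OF \<mu> S(1)]
  have "(\<integral>\<^sup>+x. (\<integral>\<^sup>+y. e2ennreal (- log_kernel x y) \<partial>\<mu>) \<partial>\<mu>) = (\<integral>\<^sup>+x. (\<integral>\<^sup>+y. 0 \<partial>\<mu>) \<partial>\<mu>)"
  proof (rule nn_integral_cong_AE, use AE in eventually_elim)
    fix x assume x: "x \<in> S"
    show "(\<integral>\<^sup>+y. e2ennreal (- log_kernel x y) \<partial>\<mu>) = (\<integral>\<^sup>+y. 0 \<partial>\<mu>)"
    proof (rule nn_integral_cong_AE, use AE in eventually_elim)
      fix y assume "y \<in> S"
      then have "0 \<le> log_kernel x y"
        using abs_le_half[OF S(2) x] abs_le_half[OF S(2), of y] by (intro log_kernel_nonneg) linarith
      then show "e2ennreal (- log_kernel x y) = 0" by (simp add: e2ennreal_neg)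
    qed
  qed
  then show ?thesis
    by (simp add: log_energy_def mutual_energy_def log_ker_def zero_ennreal.rep_eq)
qed

lemma is_equilibrium_measure_iff:
  assumes S: "S \<in> sets borel" "S \<subseteq> {- 1 / 2..1 / 2}"
  shows "is_equilibrium_measure S \<mu> \<longleftrightarrow>
    \<mu> \<in> prob_measures_on S \<and> (\<forall>\<nu>\<in>prob_measures_on S. mutual_energy \<mu> \<mu> \<le> mutual_energy \<nu> \<nu>)"
  unfolding is_equilibrium_measure_def
  using log_energy_eq_mutual_energy[OF _ S] by (auto simp: less_eq_ennreal.rep_eq)

text \<open>
  The average of a measure and its reflection, realized by a random sign.
\<close>

definition symmetrize :: "real measure \<Rightarrow> real measure" where
  "symmetrize \<mu> = distr (measure_pmf (bernoulli_pmf (1 / 2)) \<Otimes>\<^sub>M \<mu>) borel (\<lambda>p. if fst p then snd p else - snd p)"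

context
  fixes \<mu> :: "real measure"
  assumes p: "prob_space \<mu>" and sets: "sets \<mu> = sets borel"
begin

interpretation prob_space \<mu> by (fact p)

lemma symmetrize_measurable:
  "(\<lambda>p. if fst p then snd p else - snd p) \<in> borel_measurable (measure_pmf (bernoulli_pmf (1 / 2)) \<Otimes>\<^sub>M \<mu>)"
proof -
  have "Measurable.pred (measure_pmf (bernoulli_pmf (1 / 2))) (\<lambda>b. b)" by simp
  note [measurable] = this and [measurable_cong] = sets
  show ?thesis by measurable
qed

lemma prob_space_symmetrize: "prob_space (symmetrize \<mu>)"
proof -
  interpret P: pair_prob_space "measure_pmf (bernoulli_pmf (1 / 2))" \<mu>
    by unfold_locales
  show ?thesis
    unfolding symmetrize_def by (rule P.prob_space_distr[OF symmetrize_measurable])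
qed

lemma sets_symmetrize: "sets (symmetrize \<mu>) = sets borel"
  by (simp add: symmetrize_def)

lemma emeasure_symmetrize:
  assumes [measurable]: "A \<in> sets borel"
  shows "emeasure (symmetrize \<mu>) A = (emeasure \<mu> A + emeasure \<mu> (uminus -` A)) / 2"
proof -
  have sp: "space \<mu> = UNIV" using sets_eq_imp_space_eq[OF sets] by simp
  have u: "uminus -` A \<in> sets borel"
    using measurable_sets[of "uminus :: real \<Rightarrow> real" borel borel A] by simp
  have "emeasure (symmetrize \<mu>) A = emeasure (measure_pmf (bernoulli_pmf (1 / 2)) \<Otimes>\<^sub>M \<mu>)
      ({True} \<times> A \<union> {False} \<times> (uminus -` A))"
    unfolding symmetrize_def by (subst emeasure_distr[OF symmetrize_measurable])
      (auto simp: space_pair_measure sp intro!: arg_cong2[where f=emeasure] split: if_splits)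
  also have "\<dots> = emeasure (measure_pmf (bernoulli_pmf (1 / 2)) \<Otimes>\<^sub>M \<mu>) ({True} \<times> A)
      + emeasure (measure_pmf (bernoulli_pmf (1 / 2)) \<Otimes>\<^sub>M \<mu>) ({False} \<times> (uminus -` A))"
    using u sets by (intro plus_emeasure[symmetric]) auto
  also have "\<dots> = (emeasure \<mu> A + emeasure \<mu> (uminus -` A)) / 2"
    using u sets by (simp add: emeasure_pair_measure_Times emeasure_pmf_single pmf_bernoulli_True
        ennreal_divide_times divide_ennreal_def algebra_simps)
  finally show ?thesis .
qed

lemma symmetrize_symmetric: "distr (symmetrize \<mu>) borel uminus = symmetrize \<mu>"
proof (rule measure_eqI)
  show "sets (distr (symmetrize \<mu>) borel uminus) = sets (symmetrize \<mu>)"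
    by (simp add: sets_symmetrize)
  fix A assume "A \<in> sets (distr (symmetrize \<mu>) borel uminus)"
  then have A: "A \<in> sets borel" by simp
  then have u: "uminus -` A \<in> sets borel"
    using measurable_sets[of "uminus :: real \<Rightarrow> real" borel borel A] by simp
  have "uminus -` uminus -` A = A" by auto
  moreover have "space (symmetrize \<mu>) = UNIV" using sets_eq_imp_space_eq[OF sets_symmetrize] by simp
  moreover have "uminus \<in> borel_measurable (symmetrize \<mu>)"
    by (simp add: measurable_cong_sets[OF sets_symmetrize refl])
  ultimately show "emeasure (distr (symmetrize \<mu>) borel uminus) A = emeasure (symmetrize \<mu>) A"
    using A u by (simp add: emeasure_distr emeasure_symmetrize add.commute)
qed

lemma distr_symmetrize_even:
  assumes [measurable]: "f \<in> borel_measurable borel" and even: "\<And>x. f (- x) = f x"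
  shows "distr (symmetrize \<mu>) borel f = distr \<mu> borel f"
proof (rule measure_eqI)
  show "sets (distr (symmetrize \<mu>) borel f) = sets (distr \<mu> borel f)" by simp
  fix A assume "A \<in> sets (distr (symmetrize \<mu>) borel f)"
  then have A [measurable]: "A \<in> sets borel" by simp
  have fA: "f -` A \<in> sets borel"
    using measurable_sets[OF assms(1) A] by simp
  have "uminus -` f -` A = f -` A" using even by auto
  moreover have "space (symmetrize \<mu>) = UNIV" "space \<mu> = UNIV"
    using sets_eq_imp_space_eq[OF sets_symmetrize] sets_eq_imp_space_eq[OF sets] by auto
  moreover have "f \<in> borel_measurable (symmetrize \<mu>)"
    by (simp add: measurable_cong_sets[OF sets_symmetrize refl])
  moreover have "(e + e) / 2 = e" for e :: ennreal
    using ennreal_mult_divide_eq[of 2 e] by (simp add: mult_2_right)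
  ultimately show "emeasure (distr (symmetrize \<mu>) borel f) A = emeasure (distr \<mu> borel f) A"
    using fA by (simp add: emeasure_distr emeasure_symmetrize measurable_cong_sets[OF sets refl])
qed

end

lemma symmetrize_prob_measures_on:
  assumes \<mu>: "\<mu> \<in> prob_measures_on S" and S: "S \<in> sets borel" "\<And>x. x \<in> S \<Longrightarrow> - x \<in> S"
  shows "symmetrize \<mu> \<in> prob_measures_on S"
proof -
  note M = prob_measures_onD(1,2)[OF \<mu>]
  have "uminus -` S = S" using S(2) by (auto simp: vimage_def) (metis S(2) minus_minus)
  then have "emeasure (symmetrize \<mu>) S = (1 + 1) / 2"
    using \<mu> S by (simp add: emeasure_symmetrize[OF M] prob_measures_on_def del: one_add_one)
  then show ?thesis
    by (simp add: prob_measures_on_def prob_space_symmetrize[OF M] sets_symmetrize[OF M])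
qed

section \<open>Equilibrium measures under squaring\<close>

text \<open>
  This is \<open>\<bar>x - y\<bar> \<bar>x + y\<bar> = \<bar>x\<^sup>2 - y\<^sup>2\<bar>\<close>. The bounds on \<open>x\<close> and \<open>y\<close> make both summands nonnegative, so
  that the conversion to \<^typ>\<open>ennreal\<close> preserves the sum.
\<close>

lemma log_ker_square:
  assumes "\<bar>x\<bar> \<le> 1 / 2" "\<bar>y\<bar> \<le> 1 / 2"
  shows "log_ker (x\<^sup>2 - c) (y\<^sup>2 - c) = log_ker x y + log_ker x (- y)"
proof (cases "x = y \<or> x = - y")
  case True
  then show ?thesis by (auto simp: log_ker_refl)
next
  case False
  then have "x\<^sup>2 \<noteq> y\<^sup>2" by (simp add: power2_eq_iff)
  moreover have "x\<^sup>2 - y\<^sup>2 = (x - y) * (x + y)" by (simp add: power2_eq_square algebra_simps)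
  then have "ln \<bar>x\<^sup>2 - y\<^sup>2\<bar> = ln \<bar>x - y\<bar> + ln \<bar>x + y\<bar>"
    using False by (simp add: abs_mult ln_mult)
  moreover have "ln \<bar>x - y\<bar> \<le> 0" "ln \<bar>x + y\<bar> \<le> 0"
    using False assms by (auto simp: ln_le_zero_iff abs_le_iff)
  ultimately show ?thesis using False
    by (simp add: log_ker_neq ennreal_plus[symmetric] del: ennreal_plus)
qed

lemma mutual_energy_distr:
  fixes \<mu> \<nu> :: "real measure"
  assumes [measurable_cong]: "sets \<mu> = sets borel" "sets \<nu> = sets borel" and "prob_space \<nu>"
    and [measurable]: "f \<in> borel_measurable borel" "g \<in> borel_measurable borel"
  shows "mutual_energy (distr \<mu> borel f) (distr \<nu> borel g) = (\<integral>\<^sup>+x. (\<integral>\<^sup>+y. log_ker (f x) (g y) \<partial>\<nu>) \<partial>\<mu>)"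
proof -
  interpret prob_space \<nu> by fact
  have "(\<integral>\<^sup>+y. log_ker x y \<partial>distr \<nu> borel g) = (\<integral>\<^sup>+y. log_ker x (g y) \<partial>\<nu>)" for x
    by (rule nn_integral_distr) measurable
  then have "mutual_energy (distr \<mu> borel f) (distr \<nu> borel g)
      = (\<integral>\<^sup>+x. (\<integral>\<^sup>+y. log_ker x (g y) \<partial>\<nu>) \<partial>distr \<mu> borel f)"
    by (simp add: mutual_energy_def)
  also have "\<dots> = (\<integral>\<^sup>+x. (\<integral>\<^sup>+y. log_ker (f x) (g y) \<partial>\<nu>) \<partial>\<mu>)"
    by (rule nn_integral_distr) measurable
  finally show ?thesis .
qed

text \<open>
  If \<open>\<mu>\<close> is symmetric, both terms on the right are equal and squaring doubles the energy.
\<close>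

lemma mutual_energy_pushforward_square:
  assumes \<mu>: "\<mu> \<in> prob_measures_on S" and S: "S \<in> sets borel" "S \<subseteq> {- 1 / 2..1 / 2}"
  shows "mutual_energy (distr \<mu> borel (\<lambda>x. x\<^sup>2 - c)) (distr \<mu> borel (\<lambda>x. x\<^sup>2 - c))
    = mutual_energy \<mu> \<mu> + mutual_energy \<mu> (distr \<mu> borel uminus)"
proof -
  note M = prob_measures_onD(1,2)[OF \<mu>]
  note AE = prob_measures_onD(3)[OF \<mu> S(1)]
  interpret prob_space \<mu> by (rule M)
  note [measurable_cong] = M(2)
  have "mutual_energy (distr \<mu> borel (\<lambda>x. x\<^sup>2 - c)) (distr \<mu> borel (\<lambda>x. x\<^sup>2 - c))
    = (\<integral>\<^sup>+x. (\<integral>\<^sup>+y. log_ker (x\<^sup>2 - c) (y\<^sup>2 - c) \<partial>\<mu>) \<partial>\<mu>)"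
    by (rule mutual_energy_distr) (use M in measurable)
  also have "\<dots> = (\<integral>\<^sup>+x. (\<integral>\<^sup>+y. log_ker x y + log_ker x (- y) \<partial>\<mu>) \<partial>\<mu>)"
  proof (rule nn_integral_cong_AE, use AE in eventually_elim)
    fix x assume x: "x \<in> S"
    show "(\<integral>\<^sup>+y. log_ker (x\<^sup>2 - c) (y\<^sup>2 - c) \<partial>\<mu>) = (\<integral>\<^sup>+y. log_ker x y + log_ker x (- y) \<partial>\<mu>)"
    proof (rule nn_integral_cong_AE, use AE in eventually_elim)
      fix y assume "y \<in> S"
      then show "log_ker (x\<^sup>2 - c) (y\<^sup>2 - c) = log_ker x y + log_ker x (- y)"
        using x abs_le_half[OF S(2)] by (intro log_ker_square)
    qed
  qed
  also have "\<dots> = (\<integral>\<^sup>+x. (\<integral>\<^sup>+y. log_ker x y \<partial>\<mu>) + (\<integral>\<^sup>+y. log_ker x (- y) \<partial>\<mu>) \<partial>\<mu>)"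
    by (intro nn_integral_cong nn_integral_add) measurable
  also have "\<dots> = mutual_energy \<mu> \<mu> + (\<integral>\<^sup>+x. (\<integral>\<^sup>+y. log_ker x (- y) \<partial>\<mu>) \<partial>\<mu>)"
    unfolding mutual_energy_def by (rule nn_integral_add) measurable
  also have "(\<integral>\<^sup>+x. (\<integral>\<^sup>+y. log_ker x (- y) \<partial>\<mu>) \<partial>\<mu>) = mutual_energy \<mu> (distr \<mu> borel uminus)"
    unfolding mutual_energy_def
    by (intro nn_integral_cong nn_integral_distr[symmetric]) measurable
  finally show ?thesis .
qed

text \<open>
  The symmetrization has energy \<open>(J(\<mu>,\<mu>) + J(\<mu>,\<mu>\<^sup>-)) / 2\<close>, where \<open>\<mu>\<^sup>-\<close> is the reflection, so minimality
  gives \<open>J(\<mu>,\<mu>) \<le> J(\<mu>,\<mu>\<^sup>-)\<close>. As \<open>J(\<mu>\<^sup>-,\<mu>\<^sup>-) = J(\<mu>,\<mu>)\<close>, strict positive definiteness applies.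
\<close>

lemma equilibrium_measure_symmetric:
  assumes eq: "is_equilibrium_measure S \<mu>"
    and S: "S \<in> sets borel" "S \<subseteq> {- 1 / 2..1 / 2}" "\<And>x. x \<in> S \<Longrightarrow> - x \<in> S"
    and fin: "mutual_energy \<mu> \<mu> < \<infinity>"
  shows "distr \<mu> borel uminus = \<mu>"
proof -
  have \<mu>: "\<mu> \<in> prob_measures_on S" and min: "\<And>\<nu>. \<nu> \<in> prob_measures_on S \<Longrightarrow> mutual_energy \<mu> \<mu> \<le> mutual_energy \<nu> \<nu>"
    using eq is_equilibrium_measure_iff[OF S(1,2)] by auto
  note M = prob_measures_onD(1,2)[OF \<mu>]
  let ?r = "distr \<mu> borel uminus" and ?s = "symmetrize \<mu>" and ?f = "\<lambda>x::real. x\<^sup>2 - 0"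
  have s: "?s \<in> prob_measures_on S" by (rule symmetrize_prob_measures_on[OF \<mu> S(1,3)])
  have r: "?r \<in> prob_measures_on S" by (rule distr_prob_measures_on[OF \<mu> S(1) S(1)]) (use S in auto)
  note R = prob_measures_onD(1,2)[OF r]
  have rr: "mutual_energy ?r ?r = mutual_energy \<mu> \<mu>"
  proof -
    have "log_ker (- x) (- y) = log_ker x y" for x y
      by (simp add: log_ker_def log_kernel_def abs_minus_commute)
    then show ?thesis
      using mutual_energy_distr[OF M(2) M(2) M(1), of uminus uminus] by (simp add: mutual_energy_def)
  qed
  have "mutual_energy \<mu> \<mu> + mutual_energy \<mu> \<mu> \<le> mutual_energy ?s ?s + mutual_energy ?s ?s"
    using min[OF s] by (intro add_mono)
  also have "\<dots> = mutual_energy (distr ?s borel ?f) (distr ?s borel ?f)"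
    unfolding mutual_energy_pushforward_square[OF s S(1,2)] symmetrize_symmetric[OF M] ..
  also have "\<dots> = mutual_energy (distr \<mu> borel ?f) (distr \<mu> borel ?f)"
    by (subst (1 2) distr_symmetrize_even[OF M]) auto
  also have "\<dots> = mutual_energy \<mu> \<mu> + mutual_energy \<mu> ?r"
    by (rule mutual_energy_pushforward_square[OF \<mu> S(1,2)])
  finally have "mutual_energy \<mu> \<mu> \<le> mutual_energy \<mu> ?r"
    using fin by (subst (asm) ennreal_add_left_cancel_le) (auto simp: less_top)
  then have le: "mutual_energy \<mu> \<mu> + mutual_energy ?r ?r \<le> 2 * mutual_energy \<mu> ?r"
    unfolding rr mult_2 by (intro add_mono)
  have "AE x in \<mu>. \<bar>x\<bar> \<le> 1 / 2" "AE x in ?r. \<bar>x\<bar> \<le> 1 / 2"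
    by (rule eventually_mono[OF prob_measures_onD(3)[OF \<mu> S(1)]],
        rule_tac [2] eventually_mono[OF prob_measures_onD(3)[OF r S(1)]])
      (fact abs_le_half[OF S(2)])+
  from measure_eq_of_mutual_energy[OF M R this _ _ le] fin rr show ?thesis by simp
qed

text \<open>
  Every measure \<open>\<rho>\<close> on \<open>S'\<close> is the image of a symmetric measure on \<open>S\<close>: lift it by \<open>w \<mapsto> sqrt (w + c)\<close>
  and symmetrize. Passing to images doubles the energy of symmetric measures, and the minimizer on
  \<open>S\<close> is symmetric, so minimality descends.
\<close>

lemma equilibrium_measure_pushforward_square:
  assumes eq: "is_equilibrium_measure S \<mu>"
    and S: "S \<in> sets borel" "S \<subseteq> {- 1 / 2..1 / 2}"
    and S': "S' \<in> sets borel" "S' \<subseteq> {- 1 / 2..1 / 2}"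
    and SS': "\<And>x. x \<in> S \<longleftrightarrow> x\<^sup>2 - c \<in> S'" and c: "\<And>w. w \<in> S' \<Longrightarrow> 0 \<le> w + c"
    and fin: "mutual_energy \<mu> \<mu> < \<infinity>"
  defines "\<mu>' \<equiv> distr \<mu> borel (\<lambda>x. x\<^sup>2 - c)"
  shows "is_equilibrium_measure S' \<mu>'" "mutual_energy \<mu>' \<mu>' < \<infinity>"
proof -
  let ?f = "\<lambda>x::real. x\<^sup>2 - c" and ?g = "\<lambda>w. sqrt (w + c)"
  have \<mu>: "\<mu> \<in> prob_measures_on S" and min: "\<And>\<nu>. \<nu> \<in> prob_measures_on S \<Longrightarrow> mutual_energy \<mu> \<mu> \<le> mutual_energy \<nu> \<nu>"
    using eq is_equilibrium_measure_iff[OF S(1,2)] by auto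
  have sym: "- x \<in> S" if "x \<in> S" for x using that SS' by simp
  have E: "mutual_energy \<mu>' \<mu>' = mutual_energy \<mu> \<mu> + mutual_energy \<mu> \<mu>"
    using mutual_energy_pushforward_square[OF \<mu> S] equilibrium_measure_symmetric[OF eq S sym fin]
    by (simp add: \<mu>'_def)
  then show "mutual_energy \<mu>' \<mu>' < \<infinity>" using fin by simp
  show "is_equilibrium_measure S' \<mu>'"
    unfolding is_equilibrium_measure_iff[OF S']
  proof (intro conjI ballI)
    show "\<mu>' \<in> prob_measures_on S'"
      unfolding \<mu>'_def by (rule distr_prob_measures_on[OF \<mu> S(1) S'(1)]) (use SS' in auto)
    fix \<rho> assume \<rho>: "\<rho> \<in> prob_measures_on S'"
    let ?h = "distr \<rho> borel ?g"
    note R = prob_measures_onD(1,2)[OF \<rho>]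
    have h: "?h \<in> prob_measures_on S"
      by (rule distr_prob_measures_on[OF \<rho> S'(1) S(1)]) (use SS' c in auto)
    note H = prob_measures_onD(1,2)[OF h]
    have s: "symmetrize ?h \<in> prob_measures_on S"
      by (rule symmetrize_prob_measures_on[OF h S(1) sym])
    have "distr (symmetrize ?h) borel ?f = distr ?h borel ?f"
      by (rule distr_symmetrize_even[OF H]) auto
    also have "\<dots> = distr \<rho> borel (\<lambda>w. ?f (?g w))"
      using R(2) by (subst distr_distr) (auto simp: comp_def measurable_cong_sets[OF R(2) refl])
    also have "\<dots> = distr \<rho> \<rho> (\<lambda>w. w)"
      using prob_measures_onD(3)[OF \<rho> S'(1)] R(2) c
      by (intro distr_cong_AE) (auto simp: measurable_cong_sets[OF R(2) refl] measurable_ident_sets elim!: eventually_mono)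
    also have "\<dots> = \<rho>" by simp
    finally have pull_push: "distr (symmetrize ?h) borel ?f = \<rho>" .
    have "mutual_energy \<mu>' \<mu>' \<le> mutual_energy (symmetrize ?h) (symmetrize ?h)
        + mutual_energy (symmetrize ?h) (symmetrize ?h)"
      unfolding E using min[OF s] by (intro add_mono)
    also have "\<dots> = mutual_energy \<rho> \<rho>"
      using mutual_energy_pushforward_square[OF s S, of c] unfolding symmetrize_symmetric[OF H] pull_push by simp
    finally show "mutual_energy \<mu>' \<mu>' \<le> mutual_energy \<rho> \<rho>" .
  qed
qed

text \<open>
  The kernel is infinite on the diagonal, so an atom would contribute an infinite amount.
\<close>

lemma finite_energy_no_atoms:
  assumes [measurable_cong]: "sets \<mu> = sets borel" and fin: "mutual_energy \<mu> \<mu> < \<infinity>"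
  shows "emeasure \<mu> {a} = 0"
proof (rule ccontr)
  assume pos: "emeasure \<mu> {a} \<noteq> 0"
  have A: "{a} \<in> sets \<mu>" using assms(1) by simp
  have top: "\<infinity> * emeasure \<mu> {a} = \<infinity>" using pos by (simp add: ennreal_top_mult)
  have "\<infinity> * emeasure \<mu> {a} \<le> (\<integral>\<^sup>+y. log_ker a y \<partial>\<mu>)"
    unfolding nn_integral_cmult_indicator[OF A, symmetric]
    by (intro nn_integral_mono) (auto simp: indicator_def log_ker_refl)
  then have inf: "(\<integral>\<^sup>+y. log_ker a y \<partial>\<mu>) = \<infinity>"
    unfolding top by (simp add: top_unique)
  have "\<infinity> * emeasure \<mu> {a} \<le> mutual_energy \<mu> \<mu>"
    unfolding nn_integral_cmult_indicator[OF A, symmetric] mutual_energy_def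
    by (intro nn_integral_mono) (auto simp: indicator_def inf)
  then show False using fin unfolding top by (simp add: top_unique)
qed

section \<open>The levels of the Cantor set\<close>

text \<open>
  The constant left over when the square is completed: \<open>P (P + r) = (P + r / 2)\<^sup>2 - r\<^sup>2 / 4\<close>.
\<close>

definition cantor_c :: "(nat \<Rightarrow> real) \<Rightarrow> nat \<Rightarrow> real" where
  "cantor_c \<gamma> s = (cantor_r \<gamma> s)\<^sup>2 / 4 - cantor_r \<gamma> (Suc s) / 2"

definition centred_poly :: "(nat \<Rightarrow> real) \<Rightarrow> nat \<Rightarrow> real poly" where
  "centred_poly \<gamma> s = cantor_poly \<gamma> s + [:cantor_r \<gamma> s / 2:]"

lemma centred_poly_0: "centred_poly \<gamma> 0 = [:- 1 / 2, 1:]"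
  by (simp add: centred_poly_def)

lemma centred_poly_Suc: "centred_poly \<gamma> (Suc s) = (centred_poly \<gamma> s)\<^sup>2 - [:cantor_c \<gamma> s:]"
  by (rule poly_ext)
    (simp add: centred_poly_def cantor_c_def power2_eq_square algebra_simps)

fun square_iterate :: "(nat \<Rightarrow> real) \<Rightarrow> nat \<Rightarrow> nat \<Rightarrow> real \<Rightarrow> real" where
  "square_iterate c s 0 y = y"
| "square_iterate c s (Suc j) y = (square_iterate c s j y)\<^sup>2 - c (s + j)"

lemma square_iterate_Suc_shift:
  "square_iterate c s (Suc j) y = square_iterate c (Suc s) j (y\<^sup>2 - c s)"
  by (induction j) auto

lemma square_iterate_measurable [measurable]: "square_iterate c s j \<in> borel_measurable borel"
  by (induction j) (simp_all add: square_iterate.simps[abs_def])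

text \<open>
  The values at level \<open>s\<close>: \<open>x\<close> belongs to the Cantor set exactly if the value of the centred polynomial
  of level \<open>s\<close> at \<open>x\<close> belongs to this set. It is defined by the conditions that the later levels impose
  on this value, so that the relation between consecutive levels does not depend on \<open>x\<close>.
\<close>

definition value_set :: "(nat \<Rightarrow> real) \<Rightarrow> nat \<Rightarrow> real set" where
  "value_set \<gamma> s = {y. \<forall>j. square_iterate (cantor_c \<gamma>) s (Suc j) y \<le> cantor_r \<gamma> (s + Suc j) / 2}"

lemma value_set_borel: "value_set \<gamma> s \<in> sets borel"
  unfolding value_set_def by measurable

lemma poly_centred_poly:
  "poly (centred_poly \<gamma> s) x = square_iterate (cantor_c \<gamma>) 0 s (x - 1 / 2)"
  by (induction s) (simp_all add: centred_poly_0 centred_poly_Suc)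

lemma cantor_set_eq_value_set: "x \<in> cantor_set \<gamma> \<longleftrightarrow> x - 1 / 2 \<in> value_set \<gamma> 0"
proof -
  have "poly (cantor_poly \<gamma> (Suc s)) x \<le> 0
      \<longleftrightarrow> poly (centred_poly \<gamma> (Suc s)) x \<le> cantor_r \<gamma> (Suc s) / 2" for s
    unfolding centred_poly_def by simp
  then show ?thesis
    unfolding cantor_set_def cantor_level_def value_set_def poly_centred_poly by simp
qed

lemma cantor_set_borel: "cantor_set \<gamma> \<in> sets borel"
proof -
  note [measurable] = value_set_borel
  have "{x. x - 1 / 2 \<in> value_set \<gamma> 0} \<in> sets borel" by measurable
  then show ?thesis by (simp add: cantor_set_eq_value_set[symmetric])
qed

lemma poly_measurable: "sets \<mu> = sets borel \<Longrightarrow> poly (p :: real poly) \<in> borel_measurable \<mu>"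
proof -
  assume \<mu>: "sets \<mu> = sets borel"
  have "poly p \<in> borel_measurable borel" by (intro borel_measurable_continuous_onI continuous_on_poly continuous_on_id)
  then show ?thesis by (simp add: measurable_cong_sets[OF \<mu> refl])
qed

lemma log_energy_translate:
  fixes a :: real
  assumes "\<nu> \<in> prob_measures_on S"
  shows "log_energy (distr \<nu> borel (\<lambda>x. x + a)) = log_energy \<nu>"
proof -
  note N = prob_measures_onD(1,2)[OF assms]
  interpret prob_space \<nu> by (rule N)
  note [measurable_cong] = N(2)
  have [measurable]: "(\<lambda>p. e2ennreal (log_kernel (fst p) (snd p))) \<in> borel_measurable (borel \<Otimes>\<^sub>M borel)"
    "(\<lambda>p. e2ennreal (- log_kernel (fst p) (snd p))) \<in> borel_measurable (borel \<Otimes>\<^sub>M borel)"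
    unfolding log_kernel_def by measurable
  have inv: "log_kernel (x + a) (y + a) = log_kernel x y" for x y
    by (simp add: log_kernel_def)
  have shift: "(\<integral>\<^sup>+x. (\<integral>\<^sup>+y. k x y \<partial>distr \<nu> borel (\<lambda>x. x + a)) \<partial>distr \<nu> borel (\<lambda>x. x + a))
      = (\<integral>\<^sup>+x. (\<integral>\<^sup>+y. k (x + a) (y + a) \<partial>\<nu>) \<partial>\<nu>)"
    if k [measurable]: "case_prod k \<in> borel_measurable (borel \<Otimes>\<^sub>M borel)" for k :: "real \<Rightarrow> real \<Rightarrow> ennreal"
  proof -
    have "(\<integral>\<^sup>+x. (\<integral>\<^sup>+y. k x y \<partial>distr \<nu> borel (\<lambda>x. x + a)) \<partial>distr \<nu> borel (\<lambda>x. x + a))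
       = (\<integral>\<^sup>+x. (\<integral>\<^sup>+y. k x (y + a) \<partial>\<nu>) \<partial>distr \<nu> borel (\<lambda>x. x + a))"
      by (intro nn_integral_cong nn_integral_distr) measurable
    also have "\<dots> = (\<integral>\<^sup>+x. (\<integral>\<^sup>+y. k (x + a) (y + a) \<partial>\<nu>) \<partial>\<nu>)"
      by (intro nn_integral_distr) measurable
    finally show ?thesis .
  qed
  show ?thesis
    unfolding log_energy_def by (subst (1 2) shift) (simp_all add: inv case_prod_beta)
qed

locale cantor_parameters =
  fixes \<gamma> :: "nat \<Rightarrow> real"
  assumes gamma: "\<And>i. i \<ge> 1 \<Longrightarrow> 0 < \<gamma> i \<and> \<gamma> i < 1 / 4"
begin

lemma cantor_r_bounds: "0 < cantor_r \<gamma> s" "cantor_r \<gamma> s \<le> 1"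
proof -
  have "0 < cantor_r \<gamma> s \<and> cantor_r \<gamma> s \<le> 1"
  proof (induction s)
    case (Suc s)
    then have "(cantor_r \<gamma> s)\<^sup>2 \<le> 1" by (simp add: power_le_one)
    then have "\<gamma> (Suc s) * (cantor_r \<gamma> s)\<^sup>2 \<le> 1 * 1"
      using gamma[of "Suc s"] by (intro mult_mono) auto
    then show ?case using Suc gamma[of "Suc s"] by simp
  qed simp
  then show "0 < cantor_r \<gamma> s" "cantor_r \<gamma> s \<le> 1" by auto
qed

lemma value_set_bound:
  assumes "y \<in> value_set \<gamma> s"
  shows "\<bar>y\<bar> \<le> cantor_r \<gamma> s / 2"
proof -
  have "square_iterate (cantor_c \<gamma>) s (Suc 0) y \<le> cantor_r \<gamma> (s + Suc 0) / 2"
    using assms unfolding value_set_def by blast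
  then have "y\<^sup>2 \<le> (cantor_r \<gamma> s / 2)\<^sup>2"
    by (simp add: cantor_c_def power_divide)
  then show ?thesis
    using cantor_r_bounds[of s] by (simp add: abs_le_square_iff[symmetric])
qed

lemma value_set_subset: "value_set \<gamma> s \<subseteq> {- 1 / 2..1 / 2}"
  using value_set_bound cantor_r_bounds(2)[of s] by (fastforce simp: abs_le_iff)

text \<open>
  From right to left the condition of level \<open>Suc s\<close> itself has to be recovered; it is implied by the
  later ones through the bound on the set of level \<open>Suc s\<close>.
\<close>

lemma value_set_iff: "y \<in> value_set \<gamma> s \<longleftrightarrow> y\<^sup>2 - cantor_c \<gamma> s \<in> value_set \<gamma> (Suc s)"
proof
  assume y: "y \<in> value_set \<gamma> s"
  then have "square_iterate (cantor_c \<gamma>) s (Suc (Suc j)) y \<le> cantor_r \<gamma> (s + Suc (Suc j)) / 2" for j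
    unfolding value_set_def by blast
  then show "y\<^sup>2 - cantor_c \<gamma> s \<in> value_set \<gamma> (Suc s)"
    unfolding value_set_def by (subst (asm) square_iterate_Suc_shift) auto
next
  assume y: "y\<^sup>2 - cantor_c \<gamma> s \<in> value_set \<gamma> (Suc s)"
  have "square_iterate (cantor_c \<gamma>) s (Suc j) y \<le> cantor_r \<gamma> (s + Suc j) / 2" for j
  proof (cases j)
    case 0
    have "y\<^sup>2 - cantor_c \<gamma> s \<le> cantor_r \<gamma> (Suc s) / 2"
      using value_set_bound[OF y] by linarith
    then show ?thesis using 0 by simp
  next
    case (Suc i)
    have "square_iterate (cantor_c \<gamma>) (Suc s) (Suc i) (y\<^sup>2 - cantor_c \<gamma> s) \<le> cantor_r \<gamma> (Suc s + Suc i) / 2"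
      using y unfolding value_set_def by blast
    then show ?thesis unfolding Suc by (subst square_iterate_Suc_shift) simp
  qed
  then show "y \<in> value_set \<gamma> s" unfolding value_set_def by blast
qed

lemma value_set_uminus: "y \<in> value_set \<gamma> s \<Longrightarrow> - y \<in> value_set \<gamma> s"
  by (subst value_set_iff, subst (asm) value_set_iff) simp

text \<open>
  This is where \<open>\<gamma> < 1 / 4\<close> enters: the interval of possible values \<open>w\<close> reaches down only to
  \<open>- cantor_r \<gamma> (Suc s) / 2\<close>, and \<open>cantor_r \<gamma> (Suc s)\<close> is at most a quarter of the square of
  \<open>cantor_r \<gamma> s\<close>.
\<close>

lemma value_set_root_exists:
  assumes "w \<in> value_set \<gamma> (Suc s)"
  shows "0 \<le> w + cantor_c \<gamma> s"
proof -
  have "\<gamma> (Suc s) * (cantor_r \<gamma> s)\<^sup>2 \<le> 1 / 4 * (cantor_r \<gamma> s)\<^sup>2"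
    using gamma[of "Suc s"] by (intro mult_right_mono) auto
  then show ?thesis
    using value_set_bound[OF assms] by (simp add: cantor_c_def abs_le_iff)
qed

text \<open>
  Level 0 is a translation of the Cantor set into \<open>{-1/2..1/2}\<close>, which preserves energies; positive
  capacity says that some measure, hence the minimizer, has finite energy. Each further level is one
  application of squaring.
\<close>

lemma pushforward_equilibrium:
  assumes cap: "log_capacity (cantor_set \<gamma>) > 0" and eq: "is_equilibrium_measure (cantor_set \<gamma>) \<mu>"
  defines "\<mu>\<^sub>T \<equiv> \<lambda>s. distr \<mu> borel (poly (centred_poly \<gamma> s))"
  shows "is_equilibrium_measure (value_set \<gamma> s) (\<mu>\<^sub>T s) \<and> mutual_energy (\<mu>\<^sub>T s) (\<mu>\<^sub>T s) < \<infinity>"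
proof (induction s)
  case 0
  let ?K = "cantor_set \<gamma>" and ?V = "value_set \<gamma> 0"
  have \<mu>: "\<mu> \<in> prob_measures_on ?K" and min: "\<And>\<nu>. \<nu> \<in> prob_measures_on ?K \<Longrightarrow> log_energy \<mu> \<le> log_energy \<nu>"
    using eq by (auto simp: is_equilibrium_measure_def)
  have T0: "\<mu>\<^sub>T 0 = distr \<mu> borel (\<lambda>x. x + (- 1 / 2))"
    unfolding \<mu>\<^sub>T_def by (intro arg_cong[where f = "distr \<mu> borel"] ext) (simp add: centred_poly_0)
  have T0': "\<mu>\<^sub>T 0 \<in> prob_measures_on ?V"
    unfolding T0 by (rule distr_prob_measures_on[OF \<mu> cantor_set_borel value_set_borel])
      (auto simp: cantor_set_eq_value_set)
  have "is_equilibrium_measure ?V (\<mu>\<^sub>T 0)"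
    unfolding is_equilibrium_measure_def
  proof (intro conjI ballI T0')
    fix \<nu> assume \<nu>: "\<nu> \<in> prob_measures_on ?V"
    have "distr \<nu> borel (\<lambda>x. x + 1 / 2) \<in> prob_measures_on ?K"
      by (rule distr_prob_measures_on[OF \<nu> value_set_borel cantor_set_borel])
        (auto simp: cantor_set_eq_value_set)
    from min[OF this] show "log_energy (\<mu>\<^sub>T 0) \<le> log_energy \<nu>"
      unfolding T0 log_energy_translate[OF \<mu>] log_energy_translate[OF \<nu>] .
  qed
  moreover have "mutual_energy (\<mu>\<^sub>T 0) (\<mu>\<^sub>T 0) < \<infinity>"
  proof -
    have "robin_constant ?K \<noteq> \<infinity>" using cap by (auto simp: log_capacity_def)
    then obtain \<nu> where "\<nu> \<in> prob_measures_on ?K" "log_energy \<nu> \<noteq> \<infinity>"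
      unfolding robin_constant_def by (metis (no_types, lifting) INF_greatest ereal_infty_less_eq(1) order_refl)
    then have "log_energy \<mu> < \<infinity>" using min by fastforce
    then have "log_energy (\<mu>\<^sub>T 0) < \<infinity>" unfolding T0 log_energy_translate[OF \<mu>] .
    then show ?thesis
      unfolding log_energy_eq_mutual_energy[OF T0' value_set_borel value_set_subset]
      by (simp add: less_ennreal.rep_eq top_ennreal.rep_eq top_ereal_def)
  qed
  ultimately show ?case by simp
next
  case (Suc s)
  have \<mu>: "sets \<mu> = sets borel"
    using eq by (simp add: is_equilibrium_measure_def prob_measures_on_def)
  have "\<mu>\<^sub>T (Suc s) = distr (\<mu>\<^sub>T s) borel (\<lambda>y. y\<^sup>2 - cantor_c \<gamma> s)"
    unfolding \<mu>\<^sub>T_def centred_poly_Suc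
    by (subst distr_distr)
      (auto simp: comp_def intro: poly_measurable[OF \<mu>] intro!: arg_cong[where f = "distr \<mu> borel"])
  then show ?case
    using equilibrium_measure_pushforward_square[OF conjunct1[OF Suc.IH] value_set_borel value_set_subset value_set_borel value_set_subset
      value_set_iff value_set_root_exists conjunct2[OF Suc.IH]] by simp
qed

lemma pushforward_symmetric:
  assumes cap: "log_capacity (cantor_set \<gamma>) > 0" and eq: "is_equilibrium_measure (cantor_set \<gamma>) \<mu>"
  shows "distr (distr \<mu> borel (poly (centred_poly \<gamma> s))) borel uminus = distr \<mu> borel (poly (centred_poly \<gamma> s))"
  using pushforward_equilibrium[OF cap eq, of s]
  by (intro equilibrium_measure_symmetric[OF _ value_set_borel value_set_subset])
    (auto intro: value_set_uminus)

lemma equilibrium_measure_no_atoms: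
  assumes cap: "log_capacity (cantor_set \<gamma>) > 0" and eq: "is_equilibrium_measure (cantor_set \<gamma>) \<mu>"
  shows "emeasure \<mu> {a} = 0"
proof -
  have \<mu>: "sets \<mu> = sets borel"
    using eq by (simp add: is_equilibrium_measure_def prob_measures_on_def)
  have "emeasure (distr \<mu> borel (poly (centred_poly \<gamma> 0))) {a - 1 / 2} = 0"
    using pushforward_equilibrium[OF cap eq, of 0] by (intro finite_energy_no_atoms) auto
  moreover have "poly (centred_poly \<gamma> 0) -` {a - 1 / 2} \<inter> space \<mu> = {a}"
    using sets_eq_imp_space_eq[OF \<mu>] by (auto simp: centred_poly_0)
  ultimately show ?thesis
    by (subst (asm) emeasure_distr) (auto intro: poly_measurable[OF \<mu>])
qed

text \<open>
  The integrand is an odd function of the value of the centred polynomial of level \<open>s\<close>, and the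
  distribution of this value is symmetric.
\<close>

lemma integral_odd_eq_0:
  assumes cap: "log_capacity (cantor_set \<gamma>) > 0" and eq: "is_equilibrium_measure (cantor_set \<gamma>) \<mu>"
  shows "(LINT x|\<mu>. poly (centred_poly \<gamma> s * pcompose h (centred_poly \<gamma> (Suc s))) x) = 0"
proof -
  have \<mu>: "sets \<mu> = sets borel"
    using eq by (simp add: is_equilibrium_measure_def prob_measures_on_def)
  let ?T = "poly (centred_poly \<gamma> s)" and ?\<phi> = "\<lambda>y. y * poly h (y\<^sup>2 - cantor_c \<gamma> s)"
  let ?\<nu> = "distr \<mu> borel ?T"
  have "?\<phi> = poly ([:0, 1:] * pcompose h ([:0, 1:]\<^sup>2 - [:cantor_c \<gamma> s:]))"
    by (simp add: fun_eq_iff poly_pcompose)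
  then have [measurable]: "?\<phi> \<in> borel_measurable borel" by (simp only: poly_measurable)
  have T: "?T \<in> borel_measurable \<mu>"
    by (rule poly_measurable[OF \<mu>])
  have "(LINT x|\<mu>. poly (centred_poly \<gamma> s * pcompose h (centred_poly \<gamma> (Suc s))) x) = (LINT y|?\<nu>. ?\<phi> y)"
    using T by (simp add: integral_distr poly_pcompose centred_poly_Suc)
  moreover have "(LINT y|?\<nu>. ?\<phi> y) = - (LINT y|?\<nu>. ?\<phi> y)"
  proof -
    have "(LINT y|?\<nu>. ?\<phi> y) = (LINT y|distr ?\<nu> borel uminus. ?\<phi> y)"
      by (simp add: pushforward_symmetric[OF cap eq])
    also have "\<dots> = (LINT y|?\<nu>. ?\<phi> (- y))"
      by (rule integral_distr) measurable
    also have "\<dots> = - (LINT y|?\<nu>. ?\<phi> y)" by simp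
    finally show ?thesis .
  qed
  then have "(LINT y|?\<nu>. ?\<phi> y) = 0" by linarith
  ultimately show ?thesis by simp
qed

end

section \<open>Monic families and binary expansions\<close>

lemma binary_product_eq:
  assumes "m < 2 ^ N"
  shows "binary_product Q m = (\<Prod>i<N. Q (2 ^ i) ^ (m div 2 ^ i mod 2))"
proof -
  have high: "m div 2 ^ i = 0" if "i > floor_log m" for i
  proof (cases "m = 0")
    case False
    have "m < 2 ^ Suc (floor_log m)" using floor_log_exp2_gt[of m] by simp
    also have "\<dots> \<le> 2 ^ i" using that by (intro power_increasing) auto
    finally show ?thesis by simp
  qed simp
  have low: "m div 2 ^ i = 0" if "i \<ge> N" for i
    using assms that by (meson div_less less_le_trans one_le_numeral power_increasing)
  show ?thesis
    unfolding binary_product_def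
  proof (rule prod.mono_neutral_cong)
    fix i assume "i \<in> {..floor_log m} - {..<N}"
    then show "Q (2 ^ i) ^ (m div 2 ^ i mod 2) = 1" using low by simp
  next
    fix i assume "i \<in> {..<N} - {..floor_log m}"
    then show "Q (2 ^ i) ^ (m div 2 ^ i mod 2) = 1" using high by simp
  qed auto
qed

lemma sum_binary_digits: "(\<Sum>i<N. (m div 2 ^ i mod 2) * 2 ^ i) = m mod 2 ^ N" for m :: nat
proof (induction N)
  case (Suc N)
  have "m mod 2 ^ Suc N = 2 ^ N * (m div 2 ^ N mod 2) + m mod 2 ^ N"
    using mod_mult2_eq[of m "2 ^ N" 2] by (simp add: mult.commute)
  then show ?case using Suc by simp
qed simp

lemma odd_part_exists: "m > 0 \<Longrightarrow> \<exists>a j. m = 2 ^ a * (2 * j + 1)" for m :: nat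
proof (induction m rule: less_induct)
  case (less m)
  show ?case
  proof (cases "even m")
    case True
    then obtain l where l: "m = 2 * l" by auto
    then have "l < m" "l > 0" using less.prems by auto
    then obtain a j where "l = 2 ^ a * (2 * j + 1)" using less.IH by blast
    then have "m = 2 ^ Suc a * (2 * j + 1)" using l by simp
    then show ?thesis by blast
  next
    case False
    then obtain j where "m = 2 * j + 1" by (auto elim: oddE)
    then have "m = 2 ^ 0 * (2 * j + 1)" by simp
    then show ?thesis by blast
  qed
qed

lemma monic_family_span:
  fixes B :: "nat \<Rightarrow> real poly"
  assumes B: "\<And>m. degree (B m) = m" "\<And>m. lead_coeff (B m) = 1"
  shows "degree p \<le> n \<Longrightarrow> \<exists>b. p = (\<Sum>m\<le>n. smult (b m) (B m))"
proof (induction n arbitrary: p)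
  case 0
  have "B 0 = [:1:]" using B[of 0] degree_eq_zeroE[of "B 0"] by (metis lead_coeff_pCons(2) pCons_0_0)
  moreover obtain a where "p = [:a:]" using 0 degree_eq_zeroE by blast
  ultimately have "p = (\<Sum>m\<le>0. smult a (B m))" by simp
  then show ?case by (intro exI[of _ "\<lambda>_. a"])
next
  case (Suc n)
  let ?q = "p - smult (coeff p (Suc n)) (B (Suc n))"
  have "degree ?q \<le> n"
  proof (rule degree_le, intro allI impI)
    fix i assume "n < i"
    then consider "i = Suc n" | "i > Suc n" by linarith
    then show "coeff ?q i = 0"
    proof cases
      case 1
      then show ?thesis using B[of "Suc n"] by simp
    next
      case 2
      then have "coeff p i = 0" "coeff (B (Suc n)) i = 0"
        using Suc.prems B(1)[of "Suc n"] by (auto intro!: coeff_eq_0)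
      then show ?thesis by simp
    qed
  qed
  then obtain b where b: "?q = (\<Sum>m\<le>n. smult (b m) (B m))" using Suc.IH by blast
  let ?b = "b(Suc n := coeff p (Suc n))"
  have "p = ?q + smult (coeff p (Suc n)) (B (Suc n))" by simp
  also have "\<dots> = (\<Sum>m\<le>n. smult (?b m) (B m)) + smult (?b (Suc n)) (B (Suc n))"
    unfolding b by (intro arg_cong2[where f = "(+)"] sum.cong) auto
  also have "\<dots> = (\<Sum>m\<le>Suc n. smult (?b m) (B m))" by simp
  finally show ?case by blast
qed

text \<open>
  The largest index with a nonzero coefficient would determine the leading term of the sum.
\<close>

lemma monic_family_independent:
  fixes B :: "nat \<Rightarrow> real poly"
  assumes B: "\<And>m. degree (B m) = m" "\<And>m. lead_coeff (B m) = 1"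
    and fin: "finite I" and zero: "(\<Sum>m\<in>I. smult (b m) (B m)) = 0" and m: "m \<in> I"
  shows "b m = 0"
proof (rule ccontr)
  assume "b m \<noteq> 0"
  define J where "J = {i \<in> I. b i \<noteq> 0}"
  have J: "finite J" "J \<noteq> {}" using fin m \<open>b m \<noteq> 0\<close> by (auto simp: J_def)
  let ?d = "Max J"
  have d: "?d \<in> I" "b ?d \<noteq> 0" using Max_in[OF J] by (auto simp: J_def)
  have other: "b i * coeff (B i) ?d = 0" if "i \<in> I - {?d}" for i
  proof (cases "b i = 0")
    case False
    then have "i \<in> J" using that by (simp add: J_def)
    then have "i < ?d" using that J(1) by (simp add: order.not_eq_order_implies_strict)
    then show ?thesis using B(1)[of i] by (simp add: coeff_eq_0)
  qed simp
  have "0 = coeff (\<Sum>m\<in>I. smult (b m) (B m)) ?d" using zero by simp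
  also have "\<dots> = (\<Sum>i\<in>I. b i * coeff (B i) ?d)" by (simp add: coeff_sum)
  also have "\<dots> = b ?d * coeff (B ?d) ?d"
    by (simp add: sum.remove[OF fin d(1)] sum.neutral other del: mult_eq_0_iff)
  also have "\<dots> = b ?d" using B[of ?d] by simp
  finally show False using d by simp
qed

section \<open>Orthogonality in a tower of squares\<close>

text \<open>
  The algebraic content of the situation: \<open>\<Lambda>\<close> is integration against the equilibrium measure and
  \<open>T\<close> is the sequence of centred polynomials.
\<close>

locale square_tower =
  fixes T :: "nat \<Rightarrow> real poly" and c :: "nat \<Rightarrow> real" and \<Lambda> :: "real poly \<Rightarrow> real"
  assumes degree_T_0: "degree (T 0) = 1" and lead_T_0: "lead_coeff (T 0) = 1"
    and T_Suc: "T (Suc s) = (T s)\<^sup>2 - [:c s:]"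
    and \<Lambda>_add: "\<Lambda> (p + q) = \<Lambda> p + \<Lambda> q"
    and \<Lambda>_smult: "\<Lambda> (smult a p) = a * \<Lambda> p"
    and \<Lambda>_odd: "\<Lambda> (T s * pcompose h (T (Suc s))) = 0"
    and \<Lambda>_definite: "\<Lambda> (p * p) = 0 \<Longrightarrow> p = 0"
begin

lemma \<Lambda>_0: "\<Lambda> 0 = 0"
  using \<Lambda>_smult[of 0 0] by simp

lemma \<Lambda>_diff: "\<Lambda> (p - q) = \<Lambda> p - \<Lambda> q"
  using \<Lambda>_add[of "p - q" q] by simp

lemma \<Lambda>_sum_mult: "\<Lambda> ((\<Sum>m\<in>I. smult (b m) (f m)) * q) = (\<Sum>m\<in>I. b m * \<Lambda> (f m * q))"
proof (cases "finite I")
  case True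
  then show ?thesis
    by (induction I rule: finite_induct) (simp_all add: \<Lambda>_0 \<Lambda>_add \<Lambda>_smult distrib_right)
qed (simp add: \<Lambda>_0)

lemma degree_T: "degree (T s) = 2 ^ s" and lead_T: "lead_coeff (T s) = 1"
proof -
  have "degree (T s) = 2 ^ s \<and> lead_coeff (T s) = 1"
  proof (induction s)
    case 0
    then show ?case using degree_T_0 lead_T_0 by simp
  next
    case (Suc s)
    then have "T s \<noteq> 0" by auto
    then have sq: "degree ((T s)\<^sup>2) = 2 ^ Suc s" "lead_coeff ((T s)\<^sup>2) = 1"
      using Suc lead_coeff_power[of "T s" 2] by (auto simp: degree_power_eq)
    have small: "degree (- [:c s:]) < degree ((T s)\<^sup>2)" unfolding sq by simp
    show ?case
      unfolding T_Suc diff_conv_add_uminus degree_add_eq_left[OF small] lead_coeff_add_le[OF small]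
      using sq small by (simp add: coeff_eq_0)
  qed
  then show "degree (T s) = 2 ^ s" "lead_coeff (T s) = 1" by auto
qed

text \<open>
  The subalgebra of polynomials in \<open>T a\<close>. These subalgebras decrease as \<open>a\<close> grows.
\<close>

definition poly_in :: "nat \<Rightarrow> real poly \<Rightarrow> bool" where
  "poly_in a p \<longleftrightarrow> (\<exists>g. p = pcompose g (T a))"

lemma poly_in_mult: "poly_in a p \<Longrightarrow> poly_in a q \<Longrightarrow> poly_in a (p * q)"
  unfolding poly_in_def by (metis pcompose_mult)

lemma poly_in_1: "poly_in a 1"
  unfolding poly_in_def by (metis pcompose_1)

lemma poly_in_power: "poly_in a p \<Longrightarrow> poly_in a (p ^ e)"
  by (induction e) (auto simp: poly_in_1 poly_in_mult)

lemma poly_in_prod: "(\<And>i. i \<in> I \<Longrightarrow> poly_in a (f i)) \<Longrightarrow> poly_in a (\<Prod>i\<in>I. f i)"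
  by (induction I rule: infinite_finite_induct) (auto simp: poly_in_1 poly_in_mult)

lemma poly_in_T: "a \<le> i \<Longrightarrow> poly_in a (T i)"
proof (induction i rule: dec_induct)
  case base
  have "T a = pcompose [:0, 1:] (T a)" by (simp add: pcompose_pCons)
  then show ?case unfolding poly_in_def by blast
next
  case (step i)
  then obtain g where "T i = pcompose g (T a)" by (auto simp: poly_in_def)
  then have "T (Suc i) = pcompose (g\<^sup>2 - [:c i:]) (T a)"
    by (simp add: T_Suc pcompose_diff pcompose_mult power2_eq_square)
  then show ?case unfolding poly_in_def by blast
qed

text \<open>
  The arguments of the factors in \<^const>\<open>binary_product\<close> are the powers \<open>2 ^ i\<close>, from which the
  logarithm recovers \<open>i\<close>.
\<close>

definition tower_basis :: "nat \<Rightarrow> real poly" where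
  "tower_basis m = binary_product (\<lambda>k. T (floor_log k)) m"

lemma tower_basis_eq: "m < 2 ^ N \<Longrightarrow> tower_basis m = (\<Prod>i<N. T i ^ (m div 2 ^ i mod 2))"
  unfolding tower_basis_def by (subst binary_product_eq) auto

lemma tower_basis_monic: "degree (tower_basis m) = m" "lead_coeff (tower_basis m) = 1"
proof -
  have m: "m < 2 ^ m" by (rule less_exp)
  have nz: "T i \<noteq> 0" for i using lead_T[of i] by auto
  have "degree (tower_basis m) = (\<Sum>i<m. degree (T i ^ (m div 2 ^ i mod 2)))"
    unfolding tower_basis_eq[OF m] using nz by (intro degree_prod_eq_sum_degree) auto
  also have "\<dots> = (\<Sum>i<m. (m div 2 ^ i mod 2) * 2 ^ i)"
    using nz by (simp add: degree_power_eq degree_T)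
  also have "\<dots> = m" unfolding sum_binary_digits using m by simp
  finally show "degree (tower_basis m) = m" .
  show "lead_coeff (tower_basis m) = 1"
    unfolding tower_basis_eq[OF m] lead_coeff_prod by (simp add: lead_coeff_power lead_T)
qed

text \<open>
  The lowest binary digit of \<open>m\<close> sits at position \<open>a\<close>; all other factors belong to higher levels and
  are polynomials in \<open>T (Suc a)\<close>.
\<close>

lemma tower_basis_odd:
  assumes "m = 2 ^ a * (2 * j + 1)"
  shows "\<exists>g. tower_basis m = T a * pcompose g (T (Suc a))"
proof -
  have m: "m < 2 ^ m" by (rule less_exp)
  have "a < m"
  proof -
    have "a < 2 ^ a" by (rule less_exp)
    also have "\<dots> \<le> m" unfolding assms by simp
    finally show ?thesis .
  qed
  have digit: "m div 2 ^ a mod 2 = 1" unfolding assms by simp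
  have low: "m div 2 ^ i mod 2 = 0" if "i < a" for i
  proof -
    from that have "\<exists>d. a = Suc (i + d)" by (rule less_imp_Suc_add)
    then obtain d where "a = Suc (i + d)" by blast
    then have "a = i + Suc d" by simp
    then have "m = 2 ^ i * (2 * (2 ^ d * (2 * j + 1)))"
      unfolding assms by (simp only: power_add power_Suc mult.assoc)
    then have "m div 2 ^ i = 2 * (2 ^ d * (2 * j + 1))" by simp
    then show ?thesis by simp
  qed
  have "tower_basis m = T a ^ (m div 2 ^ a mod 2) * (\<Prod>i\<in>{..<m} - {a}. T i ^ (m div 2 ^ i mod 2))"
    unfolding tower_basis_eq[OF m] using \<open>a < m\<close> by (subst prod.remove[of _ a]) auto
  moreover have "poly_in (Suc a) (\<Prod>i\<in>{..<m} - {a}. T i ^ (m div 2 ^ i mod 2))"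
  proof (rule poly_in_prod)
    fix i assume "i \<in> {..<m} - {a}"
    then consider "i < a" | "i \<ge> Suc a" by force
    then show "poly_in (Suc a) (T i ^ (m div 2 ^ i mod 2))"
      by cases (simp_all add: low poly_in_1 poly_in_power poly_in_T)
  qed
  ultimately show ?thesis unfolding digit poly_in_def by auto
qed

text \<open>
  If the lowest factors of two products have different levels, the product with the higher lowest
  factor is a polynomial in the level above the lower one. So their product is again of the form on
  which \<open>\<Lambda>\<close> vanishes. For \<open>m = 0\<close> the first product is empty.
\<close>

lemma tower_orthogonal:
  assumes "\<nexists>j. m = 2 ^ s * (2 * j + 1)"
  shows "\<Lambda> (tower_basis m * (T s * pcompose h (T (Suc s)))) = 0"
proof (cases "m = 0")
  case True
  then have "tower_basis m = 1" using tower_basis_eq[of 0 0] by simp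
  then show ?thesis by (simp add: \<Lambda>_odd)
next
  case False
  then obtain a j where m: "m = 2 ^ a * (2 * j + 1)" using odd_part_exists by blast
  then obtain g where g: "tower_basis m = T a * pcompose g (T (Suc a))" using tower_basis_odd by blast
  have "a \<noteq> s" using assms m by auto
  then consider "a < s" | "s < a" by linarith
  then show ?thesis
  proof cases
    case 1
    have "poly_in (Suc a) (pcompose h (T (Suc s)))"
    proof -
      obtain k where "T (Suc s) = pcompose k (T (Suc a))"
        using poly_in_T[of "Suc a" "Suc s"] 1 by (auto simp: poly_in_def)
      then show ?thesis unfolding poly_in_def by (metis pcompose_assoc)
    qed
    then have "poly_in (Suc a) (pcompose g (T (Suc a)) * (T s * pcompose h (T (Suc s))))"
      using 1 poly_in_T[of "Suc a" s] by (intro poly_in_mult) (auto simp: poly_in_def)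
    then obtain k where "pcompose g (T (Suc a)) * (T s * pcompose h (T (Suc s))) = pcompose k (T (Suc a))"
      by (auto simp: poly_in_def)
    then have "tower_basis m * (T s * pcompose h (T (Suc s))) = T a * pcompose k (T (Suc a))"
      unfolding g by (simp add: mult.assoc)
    then show ?thesis by (simp add: \<Lambda>_odd)
  next
    case 2
    have "poly_in (Suc s) (pcompose g (T (Suc a)))"
    proof -
      obtain k where "T (Suc a) = pcompose k (T (Suc s))"
        using poly_in_T[of "Suc s" "Suc a"] 2 by (auto simp: poly_in_def)
      then show ?thesis unfolding poly_in_def by (metis pcompose_assoc)
    qed
    then have "poly_in (Suc s) (T a * pcompose g (T (Suc a)) * pcompose h (T (Suc s)))"
      using 2 poly_in_T[of "Suc s" a] by (intro poly_in_mult) (auto simp: poly_in_def)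
    then obtain k where "T a * pcompose g (T (Suc a)) * pcompose h (T (Suc s)) = pcompose k (T (Suc s))"
      by (auto simp: poly_in_def)
    then have "tower_basis m * (T s * pcompose h (T (Suc s))) = T s * pcompose k (T (Suc s))"
      unfolding g by (metis mult.left_commute)
    then show ?thesis by (simp only: \<Lambda>_odd)
  qed
qed

definition is_orthogonal :: "nat \<Rightarrow> real poly \<Rightarrow> bool" where
  "is_orthogonal n p \<longleftrightarrow> degree p = n \<and> lead_coeff p = 1 \<and> (\<forall>q. degree q < n \<longrightarrow> \<Lambda> (p * q) = 0)"

lemma is_orthogonal_unique:
  assumes p: "is_orthogonal n p" and q: "is_orthogonal n q"
  shows "p = q"
proof (cases "n = 0")
  case True
  then obtain a b where "p = [:a:]" "q = [:b:]"
    using p q by (auto simp: is_orthogonal_def elim!: degree_eq_zeroE)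
  then show ?thesis using p q by (simp add: is_orthogonal_def)
next
  case False
  have "degree (p - q) < n"
    using p q False by (intro degree_lessI) (auto simp: is_orthogonal_def coeff_eq_0 le_less)
  then have "\<Lambda> (p * (p - q)) = 0" "\<Lambda> (q * (p - q)) = 0"
    using p q by (auto simp: is_orthogonal_def)
  then have "\<Lambda> ((p - q) * (p - q)) = 0"
    using \<Lambda>_diff[of "p * (p - q)" "q * (p - q)"] by (simp add: left_diff_distrib)
  then show ?thesis using \<Lambda>_definite by fastforce
qed

lemma is_orthogonal_T: "is_orthogonal (2 ^ s) (T s)"
  unfolding is_orthogonal_def
proof (intro conjI allI impI degree_T lead_T)
  fix q :: "real poly" assume q: "degree q < 2 ^ s"
  then have "degree q \<le> 2 ^ s - 1" by simp
  then obtain b where b: "q = (\<Sum>m\<le>2 ^ s - 1. smult (b m) (tower_basis m))"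
    using monic_family_span[OF tower_basis_monic] by blast
  have *: "\<Lambda> (tower_basis m * T s) = 0" if "m < 2 ^ s" for m
  proof -
    have "\<nexists>j. m = 2 ^ s * (2 * j + 1)" using that by auto
    from tower_orthogonal[OF this, of 1] show ?thesis by (simp add: pcompose_1)
  qed
  have "\<Lambda> (q * T s) = 0"
    unfolding b \<Lambda>_sum_mult
  proof (intro sum.neutral ballI)
    fix m :: nat assume "m \<in> {..2 ^ s - 1}"
    then have "m \<le> 2 ^ s - 1" by simp
    moreover have "(0::nat) < 2 ^ s" by simp
    ultimately have "m < 2 ^ s" by linarith
    then show "b m * \<Lambda> (tower_basis m * T s) = 0" using * by simp
  qed
  then show "\<Lambda> (T s * q) = 0" by (simp add: mult.commute)
qed

theorem orthogonal_poly_expansion: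
  assumes Q: "\<And>m. is_orthogonal m (Q m)" and n: "n = 2 ^ s * (2 * k + 1)"
  shows "\<exists>!a. a \<in> {..k} \<rightarrow>\<^sub>E (UNIV :: real set) \<and>
    Q n = (\<Sum>j\<le>k. smult (a j) (binary_product Q ((2 * j + 1) * 2 ^ s)))"
proof -
  \<comment> \<open>This identifies the products \<open>B\<^sub>n\<close> with the basis of the tower.\<close>
  have QT: "Q (2 ^ i) = T i" for i
    using is_orthogonal_unique[OF Q is_orthogonal_T] .
  have B: "binary_product Q m = tower_basis m" for m
    unfolding tower_basis_def binary_product_def by (simp add: QT)
  \<comment> \<open>The indices of the basis elements with lowest factor \<open>T s\<close>, in increasing order.\<close>
  define f :: "nat \<Rightarrow> nat" where "f j = (2 * j + 1) * 2 ^ s" for j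
  have inj: "inj f" by (auto simp: inj_on_def f_def)
  have sum_f: "(\<Sum>j\<le>k. smult (a j) (tower_basis (f j)))
      = (\<Sum>m\<in>f ` {..k}. smult (a (inv f m)) (tower_basis m))" for a
    by (subst sum.reindex) (auto simp: inj inj_on_subset[OF inj] inv_f_f)
  obtain b where b: "Q n = (\<Sum>m\<le>n. smult (b m) (tower_basis m))"
    using monic_family_span[OF tower_basis_monic, of "Q n" n] Q[of n] by (auto simp: is_orthogonal_def)
  have fn: "f k = n" by (simp add: f_def n)
  have sub: "f ` {..k} \<subseteq> {..n}" unfolding fn[symmetric] by (auto simp: f_def)
  \<comment> \<open>The summand \<open>u\<close> collects the basis elements with lowest factor \<open>T s\<close>, among them the one of
    degree \<open>n\<close>; the remainder \<open>v\<close> turns out to be orthogonal to itself.\<close>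
  define u where "u = (\<Sum>m\<in>f ` {..k}. smult (b m) (tower_basis m))"
  define v where "v = (\<Sum>m\<in>{..n} - f ` {..k}. smult (b m) (tower_basis m))"
  have uv: "Q n = v + u"
    unfolding b u_def v_def by (rule sum.subset_diff[OF sub]) simp
  have "\<exists>h. u = T s * pcompose h (T (Suc s))"
  proof -
    have "\<forall>j. \<exists>g. tower_basis (f j) = T s * pcompose g (T (Suc s))"
      using tower_basis_odd[of _ s] by (simp add: f_def mult.commute)
    then obtain g where g: "\<And>j. tower_basis (f j) = T s * pcompose (g j) (T (Suc s))" by metis
    have "u = (\<Sum>j\<le>k. smult (b (f j)) (tower_basis (f j)))"
      unfolding u_def by (subst sum.reindex) (auto simp: inj_on_subset[OF inj])
    also have "\<dots> = T s * pcompose (\<Sum>j\<le>k. smult (b (f j)) (g j)) (T (Suc s))"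
      by (simp add: g pcompose_sum pcompose_smult sum_distrib_left)
    finally show ?thesis by blast
  qed
  then obtain h where h: "u = T s * pcompose h (T (Suc s))" by blast
  have "\<Lambda> (tower_basis m * u) = 0" if "m \<in> {..n} - f ` {..k}" for m
  proof -
    have "\<nexists>j. m = 2 ^ s * (2 * j + 1)"
    proof
      assume "\<exists>j. m = 2 ^ s * (2 * j + 1)"
      then obtain j where j: "m = f j" by (auto simp: f_def mult.commute)
      have "f j \<le> f k" using that unfolding j fn by simp
      then have "j \<le> k" by (simp add: f_def)
      then show False using that j by auto
    qed
    then show ?thesis unfolding h by (rule tower_orthogonal)
  qed
  then have "\<Lambda> (v * u) = 0" unfolding v_def \<Lambda>_sum_mult by (intro sum.neutral) auto
  moreover have "degree v < n"
  proof -
    have "degree v \<le> n - 1"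
      unfolding v_def
    proof (rule degree_sum_le)
      fix m assume "m \<in> {..n} - f ` {..k}"
      then have "m \<le> n" "m \<noteq> n" using fn by auto
      then show "degree (smult (b m) (tower_basis m)) \<le> n - 1"
        by (intro order_trans[OF degree_smult_le]) (simp add: tower_basis_monic)
    qed simp
    moreover have "n > 0" by (simp add: n)
    ultimately show ?thesis by linarith
  qed
  then have "\<Lambda> (Q n * v) = 0" using Q[of n] by (simp add: is_orthogonal_def)
  then have "\<Lambda> (v * v) + \<Lambda> (u * v) = 0" unfolding uv by (simp add: distrib_right \<Lambda>_add)
  ultimately have "\<Lambda> (v * v) = 0" by (simp add: mult.commute)
  then have "v = 0" by (rule \<Lambda>_definite)
  then have Qu: "Q n = u" using uv by simp
  show ?thesis
    unfolding B f_def[symmetric]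
  proof (rule ex1I)
    show "restrict (\<lambda>j. b (f j)) {..k} \<in> {..k} \<rightarrow>\<^sub>E UNIV \<and>
        Q n = (\<Sum>j\<le>k. smult (restrict (\<lambda>j. b (f j)) {..k} j) (tower_basis (f j)))"
      unfolding Qu u_def by (subst sum.reindex) (auto simp: inj_on_subset[OF inj])
  next
    fix a assume a: "a \<in> {..k} \<rightarrow>\<^sub>E UNIV \<and> Q n = (\<Sum>j\<le>k. smult (a j) (tower_basis (f j)))"
    then have "Q n = (\<Sum>m\<in>f ` {..k}. smult (a (inv f m)) (tower_basis m))"
      by (simp only: sum_f)
    then have "(\<Sum>m\<in>f ` {..k}. smult (a (inv f m) - b m) (tower_basis m)) = Q n - u"
      by (simp only: smult_diff_left sum_subtractf u_def)
    then have zero: "(\<Sum>m\<in>f ` {..k}. smult (a (inv f m) - b m) (tower_basis m)) = 0"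
      unfolding Qu by simp
    have "a (inv f m) - b m = 0" if "m \<in> f ` {..k}" for m
      by (rule monic_family_independent[OF tower_basis_monic _ zero that]) simp
    then have "a j = b (f j)" if "j \<le> k" for j
      using that inv_f_f[OF inj, of j] by (metis atMost_iff eq_iff_diff_eq_0 imageI)
    then show "a = restrict (\<lambda>j. b (f j)) {..k}"
      using a by (auto simp: PiE_def extensional_def restrict_def fun_eq_iff)
  qed
qed

end

section \<open>Expansion of the orthogonal polynomials\<close>

text \<open>
  Polynomials are bounded on \<open>{0..1}\<close>, which contains the Cantor set.
\<close>

lemma (in cantor_parameters) integrable_poly_on_cantor_set:
  assumes \<mu>: "\<mu> \<in> prob_measures_on (cantor_set \<gamma>)"
  shows "integrable \<mu> (poly p)"
proof -
  note M = prob_measures_onD(1,2)[OF \<mu>]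
  interpret prob_space \<mu> by (rule M)
  have "compact (poly p ` {0..1})"
    by (intro compact_continuous_image continuous_on_poly continuous_on_id) simp
  then have "bounded (poly p ` {0..1})" by (rule compact_imp_bounded)
  then obtain C where "\<forall>y\<in>poly p ` {0..1}. norm y \<le> C" unfolding bounded_iff by blast
  then have C: "norm (poly p x) \<le> C" if "x \<in> {0..1}" for x using that by blast
  have "AE x in \<mu>. norm (poly p x) \<le> C"
    using prob_measures_onD(3)[OF \<mu> cantor_set_borel]
  proof eventually_elim
    case (elim x)
    then have "x - 1 / 2 \<in> {- 1 / 2..1 / 2}"
      using value_set_subset[of 0] by (auto simp: cantor_set_eq_value_set)
    then show ?case by (intro C) auto
  qed
  then show ?thesis by (rule integrable_const_bound[OF _ poly_measurable[OF M(2)]])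
qed

theorem theorem3p4:
  fixes \<gamma> :: "nat \<Rightarrow> real" and \<mu> :: "real measure" and Q :: "nat \<Rightarrow> real poly"
    and n s k :: nat
  assumes gamma: "\<And>i. i \<ge> 1 \<Longrightarrow> 0 < \<gamma> i \<and> \<gamma> i < 1 / 4"
    and capacity: "log_capacity (cantor_set \<gamma>) > 0"
    and equilibrium: "is_equilibrium_measure (cantor_set \<gamma>) \<mu>"
    and orthogonal: "\<And>m. is_monic_orthogonal_poly \<mu> m (Q m)"
    and n: "n = 2 ^ s * (2 * k + 1)"
  shows "\<exists>!a. a \<in> {..k} \<rightarrow>\<^sub>E (UNIV :: real set) \<and>
           Q n = (\<Sum>j\<le>k. smult (a j) (binary_product Q ((2 * j + 1) * 2 ^ s)))"
proof -
  interpret cantor_parameters \<gamma> by unfold_locales (rule gamma)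
  have \<mu>: "\<mu> \<in> prob_measures_on (cantor_set \<gamma>)"
    using equilibrium by (simp add: is_equilibrium_measure_def)
  note M = prob_measures_onD(1,2)[OF \<mu>]
  interpret prob_space \<mu> by (rule M)
  note int = integrable_poly_on_cantor_set[OF \<mu>]
  let ?\<Lambda> = "\<lambda>p. LINT x|\<mu>. poly p x"
  interpret square_tower "centred_poly \<gamma>" "cantor_c \<gamma>" ?\<Lambda>
  proof
    fix p :: "real poly" assume "?\<Lambda> (p * p) = 0"
    then have AE: "AE x in \<mu>. poly (p * p) x = 0"
      by (subst (asm) integral_nonneg_eq_0_iff_AE[OF int]) auto
    show "p = 0"
    proof (rule ccontr)
      assume "p \<noteq> 0"
      then have fin: "finite {x. poly p x = 0}" by (rule poly_roots_finite)
      \<comment> \<open>The measure has no atoms, so it does not charge the finite set of roots.\<close>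
      have "AE x in \<mu>. \<forall>a\<in>{x. poly p x = 0}. x \<noteq> a"
      proof (rule AE_finite_allI[OF fin])
        fix a
        have "{a} \<in> null_sets \<mu>"
          using equilibrium_measure_no_atoms[OF capacity equilibrium] M(2) by (auto simp: null_sets_def)
        from AE_not_in[OF this] show "AE x in \<mu>. x \<noteq> a" by simp
      qed
      with AE have "AE x in \<mu>. False" by eventually_elim auto
      then show False using AE_False by simp
    qed
  qed (use int integral_odd_eq_0[OF capacity equilibrium] in
      \<open>auto simp: centred_poly_0 centred_poly_Suc[of \<gamma>] simp del: poly_mult\<close>)
  have "is_orthogonal m (Q m)" for m
    using orthogonal[of m] unfolding is_monic_orthogonal_poly_def is_orthogonal_def poly_mult .
  then show ?thesis using n by (rule orthogonal_poly_expansion)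
qed

end
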